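(* Let $m \geq 5$ be an integer. Then $$\frac{64}{25} m^2 -23m +51 \leq \mathsf{D} (\mathcal{B}^{(2)}_m) \leq \frac{5 \pi}{4} \left( m+ \frac{4}{\sqrt{5}} \right)^2.$$ Moreover, as $m \to + \infty$, $$\frac{3 \sqrt{3}}{2} m^2 + O(m^{1.1}) \leq \mathsf{D} (\mathcal{B}^{(2)}_m) \leq \frac{5 \pi}{4} m^2 + O(m).$$
   Context: A sequence over a subset $X$ of an abelian group $G$ is a finite unordered sequence (multiset) $x_1,\dots,x_n$ of elements of $X$; $n$ is its length. It is a zero-sum sequence if $\sum_{i=1}^n x_i=0$, and a minimal zero-sum sequence if moreover $\sum_{i\in I}x_i\neq 0$ for every non-empty proper subset $I\subsetneq\{1,\dots,n\}$. The Davenport constant $\mathsf{D}(X)$ is the largest length of a minimal zero-sum sequence over $X$. For positive integers $d,m$, $\mathcal{B}^{(d)}_m=\{(u_1,\dots,u_d)\in\mathbb{Z}^d : u_1^2+\cdots+u_d^2\le m^2\}$, a subset of the group $\mathbb{Z}^d$. *)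

theory Defs
  imports "HOL-Analysis.Analysis" "HOL-Library.Multiset" "HOL-Library.Landau_Symbols"
begin

definition zero_sum :: "'a::ab_group_add multiset \<Rightarrow> bool" where
  "zero_sum S \<longleftrightarrow> sum_mset S = 0"

definition minimal_zero_sum :: "'a::ab_group_add multiset \<Rightarrow> bool" where
  "minimal_zero_sum S \<longleftrightarrow>
     zero_sum S \<and> (\<forall>T. T \<subset># S \<and> T \<noteq> {#} \<longrightarrow> \<not> zero_sum T)"

text \<open>
  The supremum is taken in the extended naturals: it is infinite when the lengths are
  unbounded, and otherwise it is the largest length. The empty sequence is minimal
  zero-sum and contributes only the length 0.
\<close>

definition davenport :: "'a::ab_group_add set \<Rightarrow> enat" where
  "davenport X = (SUP S \<in> {S. set_mset S \<subseteq> X \<and> minimal_zero_sum S}. enat (size S))"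

text \<open>The dimension $d$ is the cardinality of the index type.\<close>

definition int_ball :: "nat \<Rightarrow> (int ^ 'd::finite) set" where
  "int_ball m = {u. (\<Sum>i\<in>UNIV. (u $ i)\<^sup>2) \<le> (int m)\<^sup>2}"

end

theory Submission imports Defs "HOL-Real_Asymp.Real_Asymp" begin

text \<open>
  Upper bound: vectors of norm at most one in the plane with sum zero can be ordered such that all
  partial sums have norm at most \<open>sqrt 5 / 2\<close> (the Steinitz constant of the Euclidean plane). The
  partial sums of a minimal zero-sum sequence are distinct lattice points, so the length is at most
  the number of lattice points in a disc of radius \<open>sqrt 5 / 2 * m\<close>, which is compared with an area.

  For the ordering, vectors are removed from a set \<open>A\<close> while the sum \<open>T\<close> of \<open>A\<close> stays within distance
  \<open>1/2\<close> of a segment from \<open>0\<close> to some \<open>x y\<close> with \<open>y \<in> A\<close>. Write \<open>T = h + c x y\<close> with \<open>h\<close> as short as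
  possible. Linear relations between three vectors allow one to shrink \<open>h\<close>, and then to increase the
  coefficients of a pair representation \<open>T = k x i + l x j\<close>, until some coefficient reaches one and
  that vector can be removed. A remaining fractional coefficient \<open>c\<close> is harmless because
  \<open>(1 - c) |h + c b|^2 + c |h - (1 - c) b|^2 = |h|^2 + c (1 - c) |b|^2\<close>: one of the two ways of rounding
  it adds at most \<open>1/4\<close> to the square of the norm.

  Lower bound: three vectors near the vertices of an inscribed equilateral triangle, repeated
  according to their linear relation.
\<close>

section \<open>Rounding and linear relations\<close>

lemma rounding_identity:
  fixes h b :: "'a::real_inner"
  shows "(1 - c) * (norm (h + c *\<^sub>R b))\<^sup>2 + c * (norm (h - (1 - c) *\<^sub>R b))\<^sup>2
           = (norm h)\<^sup>2 + c * (1 - c) * (norm b)\<^sup>2"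
  unfolding power2_norm_eq_inner
  by (simp add: inner_add_left inner_add_right inner_diff_left
      inner_diff_right inner_commute[of b h]) (simp add: algebra_simps)

lemma rounding_bound:
  fixes h b :: "'a::real_inner"
  assumes "0 \<le> c" "c \<le> 1" "norm b \<le> 1"
  shows "(1 - c) * (norm (h + c *\<^sub>R b))\<^sup>2 + c * (norm (h - (1 - c) *\<^sub>R b))\<^sup>2
           \<le> (norm h)\<^sup>2 + c * (1 - c)"
proof -
  have "c * (1 - c) * (norm b)\<^sup>2 \<le> c * (1 - c) * 1"
    using assms by (intro mult_left_mono) (auto simp: abs_square_le_1)
  then show ?thesis using rounding_identity[of c h b] by simp
qed

text \<open>In uses, \<open>h + c b\<close> is a sum containing \<open>b\<close>, and
  \<open>h - (1 - c) b\<close> is the sum without it. If removing \<open>b\<close> misses radius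
  1/2, its square takes at least \<open>c / 4\<close> of the weighted mean, leaving at most
  \<open>(1 - c) (1/4 + c)\<close> for the other term.\<close>

lemma rounding_up_bound:
  fixes h b :: "'a::real_inner"
  assumes c: "0 \<le> c" "c \<le> 1" and b: "norm b \<le> 1" and h: "norm h \<le> 1 / 2"
    and u: "norm (h - (1 - c) *\<^sub>R b) > 1 / 2"
  shows "(norm (h + c *\<^sub>R b))\<^sup>2 \<le> 5 / 4"
proof (cases "c = 1")
  case True
  then show ?thesis using u h by simp
next
  case False
  have "(norm h)\<^sup>2 \<le> (1/2)\<^sup>2" using h by (intro power_mono) auto
  moreover have "(1/2)\<^sup>2 \<le> (norm (h - (1 - c) *\<^sub>R b))\<^sup>2" using u by (intro power_mono) auto
  then have "c * (1/2)\<^sup>2 \<le> c * (norm (h - (1 - c) *\<^sub>R b))\<^sup>2" using c by (intro mult_left_mono)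
  ultimately have "(1 - c) * (norm (h + c *\<^sub>R b))\<^sup>2 \<le> 1/4 + c * (1 - c) - c/4"
    using rounding_bound[OF c b, of h] by (simp add: power_divide)
  also have "\<dots> = (1 - c) * (1/4 + c)" by (simp add: field_simps)
  finally have "(1 - c) * (norm (h + c *\<^sub>R b))\<^sup>2 \<le> (1 - c) * (1/4 + c)" .
  then have "(norm (h + c *\<^sub>R b))\<^sup>2 \<le> 1/4 + c" using c False by simp
  then show ?thesis using c by simp
qed

text \<open>A square above 5/4 takes at least \<open>5 c / 4\<close> of the weighted mean, which
  leaves \<open>1/4 - c/4 - c^2\<close>, at most \<open>(1 - c) / 4\<close>, for the other
  term.\<close>

lemma rounding_down_bound:
  fixes h b :: "'a::real_inner"
  assumes c: "0 \<le> c" "c \<le> 1" and b: "norm b \<le> 1" and h: "norm h \<le> 1 / 2"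
    and u: "(norm (h - (1 - c) *\<^sub>R b))\<^sup>2 > 5 / 4"
  shows "norm (h + c *\<^sub>R b) \<le> 1 / 2"
proof (cases "c = 1")
  case True
  have "(norm h)\<^sup>2 \<le> (1/2)\<^sup>2" using h by (intro power_mono) auto
  then show ?thesis using u True by (simp add: power2_eq_square)
next
  case False
  have "(norm h)\<^sup>2 \<le> (1/2)\<^sup>2" using h by (intro power_mono) auto
  moreover have "c * (5/4) \<le> c * (norm (h - (1 - c) *\<^sub>R b))\<^sup>2" using c u by (intro mult_left_mono) auto
  ultimately have "(1 - c) * (norm (h + c *\<^sub>R b))\<^sup>2 \<le> 1/4 - c/4 - c\<^sup>2"
    using rounding_bound[OF c b, of h] by (simp add: power2_eq_square algebra_simps)
  also have "\<dots> \<le> (1 - c) * (1/4)" by (simp add: algebra_simps)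
  finally have "(norm (h + c *\<^sub>R b))\<^sup>2 \<le> (1/2)\<^sup>2" using c False by (simp add: power2_eq_square)
  then show ?thesis by (rule power2_le_imp_le) simp
qed

text \<open>The four points are the corners of a parallelogram. Since
  \<open>-2 (a \<bullet> b)\<close> is at most \<open>|a|^2 + |b|^2\<close>, the squares at the two
  middle corners add up to at most 1/4 + 1/4 + 1 + 1 = 5/2.\<close>

lemma parallelogram_corner_bound:
  fixes t a b :: "'a::real_inner"
  assumes "norm a \<le> 1" "norm b \<le> 1" "norm t \<le> 1 / 2" "norm (t - a - b) \<le> 1 / 2"
  shows "(norm (t - a))\<^sup>2 \<le> 5 / 4 \<or> (norm (t - b))\<^sup>2 \<le> 5 / 4"
proof -
  have "(norm (t - a))\<^sup>2 + (norm (t - b))\<^sup>2 =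
          (norm t)\<^sup>2 + (norm (t - a - b))\<^sup>2 - 2 * (a \<bullet> b)"
    by (simp add: power2_norm_eq_inner inner_diff_left inner_diff_right inner_commute)
  moreover have "- 2 * (a \<bullet> b) = (norm a)\<^sup>2 + (norm b)\<^sup>2 - (norm (a + b))\<^sup>2"
    by (simp add: power2_norm_eq_inner inner_add_left inner_add_right inner_commute)
  moreover have "(norm (a + b))\<^sup>2 \<ge> 0" by simp
  ultimately have "(norm (t - a))\<^sup>2 + (norm (t - b))\<^sup>2 \<le>
          (norm t)\<^sup>2 + (norm (t - a - b))\<^sup>2 + (norm a)\<^sup>2 + (norm b)\<^sup>2" by linarith
  moreover have "(norm t)\<^sup>2 \<le> (1/2)\<^sup>2" "(norm (t - a - b))\<^sup>2 \<le> (1/2)\<^sup>2"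
     "(norm a)\<^sup>2 \<le> 1\<^sup>2" "(norm b)\<^sup>2 \<le> 1\<^sup>2"
    using assms by (intro power_mono; simp)+
  ultimately have "(norm (t - a))\<^sup>2 + (norm (t - b))\<^sup>2 \<le> 5 / 2"
    by (simp add: power2_eq_square)
  then show ?thesis by linarith
qed

section \<open>Moves inside the unit cube and linear relations\<close>

text \<open>The ray from \<open>k\<close> in direction \<open>d\<close> is followed until it leaves
  the cube; \<open>r i\<close> is the exit time of coordinate \<open>i\<close>. The sign hypotheses
  keep \<open>d\<close> from pointing outwards at a face containing \<open>k\<close>, so the exit
  time is positive.\<close>

lemma ray_to_boundary:
  fixes k d :: "'i \<Rightarrow> real"
  assumes F: "finite F" and ne: "\<exists>i\<in>F. d i \<noteq> 0"
    and k: "\<And>i. i \<in> F \<Longrightarrow> 0 \<le> k i \<and> k i \<le> 1"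
    and up: "\<And>i. i \<in> F \<Longrightarrow> d i > 0 \<Longrightarrow> k i < 1" and dn: "\<And>i. i \<in> F \<Longrightarrow> d i < 0 \<Longrightarrow> k i > 0"
  obtains t i where "t > 0" "\<And>j. j \<in> F \<Longrightarrow> 0 \<le> k j + t * d j \<and> k j + t * d j \<le> 1"
    "i \<in> F" "k i + t * d i = 1 \<and> d i > 0 \<or> k i + t * d i = 0 \<and> d i < 0"
proof -
  define r where "r = (\<lambda>i. if d i > 0 then (1 - k i) / d i else k i / (- d i))"
  define G where "G = {i\<in>F. d i \<noteq> 0}"
  have G: "finite G" "G \<noteq> {}" using F ne by (auto simp: G_def)
  define t where "t = Min (r ` G)"
  have "t \<in> r ` G" unfolding t_def using G by (intro Min_in) auto
  then obtain i where i: "i \<in> G" "t = r i" by auto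
  have tle: "t \<le> r j" if "j \<in> G" for j unfolding t_def using G that by simp
  have rpos: "r j > 0" if "j \<in> G" for j
    using that up[of j] dn[of j] by (auto simp: G_def r_def divide_pos_neg)
  have tpos: "t > 0" using rpos i by simp
  have "0 \<le> k j + t * d j \<and> k j + t * d j \<le> 1" if j: "j \<in> F" for j
  proof (cases "d j" "0::real" rule: linorder_cases)
    case less
    then have "t \<le> k j / (- d j)" using tle[of j] j by (simp add: G_def r_def)
    then have "t * (- d j) \<le> k j" using less by (subst (asm) pos_le_divide_eq) auto
    moreover have "t * d j \<le> 0" using tpos less by (simp add: mult_nonneg_nonpos)
    ultimately show ?thesis using k[OF j] by auto
  next
    case equal
    then show ?thesis using k[OF j] by simp
  next
    case greater
    then have "t \<le> (1 - k j) / d j" using tle[of j] j by (simp add: G_def r_def)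
    then have "t * d j \<le> 1 - k j" using greater by (subst (asm) pos_le_divide_eq) auto
    moreover have "t * d j \<ge> 0" using tpos greater by simp
    ultimately show ?thesis using k[OF j] by auto
  qed
  moreover have "k i + t * d i = 1 \<and> d i > 0 \<or> k i + t * d i = 0 \<and> d i < 0"
    using i by (auto simp: r_def G_def)
  ultimately show ?thesis using that[of t i] tpos i by (auto simp: G_def)
qed

text \<open>Stated for families, because equal vectors at different indices must also yield a
  relation, with coefficients 1 and -1.\<close>

lemma linear_dependence_of_family:
  fixes V :: "'i \<Rightarrow> 'a::euclidean_space"
  assumes "finite J" "card J > DIM('a)"
  obtains e where "\<exists>j\<in>J. e j \<noteq> 0" "(\<Sum>j\<in>J. e j *\<^sub>R V j) = 0"
proof (cases "inj_on V J")
  case True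
  have "dependent (V ` J)"
    using assms True by (intro dependent_biggerset) (auto simp: card_image)
  then obtain u v where uv: "(\<Sum>v\<in>V ` J. u v *\<^sub>R v) = 0" "v \<in> V ` J" "u v \<noteq> 0"
    using assms by (subst (asm) dependent_finite) auto
  show ?thesis
    by (rule that[of "u \<circ> V"]) (use uv True in \<open>auto simp: sum.reindex\<close>)
next
  case False
  then obtain i j where ij: "i \<in> J" "j \<in> J" "i \<noteq> j" "V i = V j" by (auto simp: inj_on_def)
  define e where "e = (\<lambda>l. if l = i then 1 else if l = j then -1 else (0::real))"
  have "(\<Sum>l\<in>J. e l *\<^sub>R V l) = (\<Sum>l\<in>{i,j}. e l *\<^sub>R V l)"
    using assms ij by (intro sum.mono_neutral_right) (auto simp: e_def)
  also have "\<dots> = 0" using ij by (simp add: e_def)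
  finally have "(\<Sum>l\<in>J. e l *\<^sub>R V l) = 0" .
  moreover have "e i \<noteq> 0" by (simp add: e_def)
  ultimately show ?thesis using that[of e] ij by blast
qed

text \<open>A Caratheodory reduction: while more than three indices remain, an affine relation is
  used to cancel the weight of one index outside \<open>Y\<close>. The total weight is unchanged and
  the weights outside \<open>Y\<close> stay nonnegative.\<close>

lemma small_support_direction:
  fixes x :: "'i \<Rightarrow> 'a::euclidean_space"
  assumes dim: "DIM('a) = 2"
    and "finite J" "Y \<subseteq> J"
    and indep: "\<And>e. (\<Sum>i\<in>Y. e i *\<^sub>R x i) = 0 \<Longrightarrow> \<forall>i\<in>Y. e i = 0"
    and "(\<Sum>i\<in>J. w i *\<^sub>R x i) = 0" "\<And>i. i \<in> J - Y \<Longrightarrow> w i \<ge> 0" "(\<Sum>i\<in>J. w i) > 0"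
    and "card J \<ge> 3"
  shows "\<exists>F d. Y \<subseteq> F \<and> F \<subseteq> J \<and> card F = 3 \<and> (\<Sum>i\<in>F. d i *\<^sub>R x i) = 0 \<and>
           (\<forall>i\<in>F - Y. d i \<ge> 0) \<and> (\<Sum>i\<in>F. d i) > (0::real)"
  using assms(2,3,5-)
proof (induction "card J" arbitrary: J w rule: less_induct)
  case less
  show ?case
  proof (cases "card J = 3")
    case True
    then show ?thesis using less.prems by blast
  next
    case False
    \<comment> \<open>The extra coordinate 1 forces the coefficients of the relation to sum to zero,
      which preserves the total weight.\<close>
    then have "card J > DIM('a \<times> real)" using less.prems dim by simp
    from linear_dependence_of_family[OF less.prems(1) this, of "\<lambda>i. (x i, 1)"]
    obtain e where e: "\<exists>j\<in>J. e j \<noteq> 0" "(\<Sum>j\<in>J. e j *\<^sub>R (x j, 1::real)) = 0" by metis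
    have e0: "(\<Sum>j\<in>J. e j *\<^sub>R x j) = 0" "(\<Sum>j\<in>J. e j) = 0"
      using arg_cong[OF e(2), of fst] arg_cong[OF e(2), of snd] by (simp_all add: fst_sum snd_sum)
    have "\<exists>j\<in>J - Y. e j \<noteq> 0"
    proof (rule ccontr)
      assume *: "\<not> ?thesis"
      have "(\<Sum>j\<in>Y. e j *\<^sub>R x j) = (\<Sum>j\<in>J. e j *\<^sub>R x j)"
        using less.prems * by (intro sum.mono_neutral_left) auto
      then show False using indep[of e] e0 e(1) * by auto
    qed
    then obtain j where j: "j \<in> J - Y" "e j \<noteq> 0" by blast
    \<comment> \<open>The sign makes \<open>f j\<close> negative, so some weight outside
      \<open>Y\<close> decreases along \<open>f\<close>; the least ratio \<open>t\<close> is the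
      moment when the first one, at \<open>l\<close>, vanishes.\<close>
    define f where "f = (\<lambda>i. - sgn (e j) * e i)"
    have f: "(\<Sum>j\<in>J. f j *\<^sub>R x j) = 0" "(\<Sum>j\<in>J. f j) = 0"
      using e0 by (simp_all add: f_def scaleR_sum_right[symmetric] sum_distrib_left[symmetric] sum_negf
           flip: scaleR_scaleR)
    define G where "G = {i\<in>J - Y. f i < 0}"
    have "f j < 0" using j by (auto simp: f_def sgn_if)
    then have G: "finite G" "G \<noteq> {}" using less.prems j by (auto simp: G_def)
    define t where "t = Min ((\<lambda>i. w i / (- f i)) ` G)"
    have "t \<in> (\<lambda>i. w i / (- f i)) ` G" unfolding t_def using G by (intro Min_in) auto
    then obtain l where l: "l \<in> G" "t = w l / (- f l)" by auto
    have t0: "t \<ge> 0" using l less.prems(4)[of l] by (auto simp: G_def intro!: divide_nonneg_neg)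
    have tle: "t \<le> w i / (- f i)" if "i \<in> G" for i unfolding t_def using G that by (intro Min_le) auto
    define v where "v = (\<lambda>i. w i + t * f i)"
    have vl: "v l = 0" using l by (auto simp: v_def G_def)
    have v0: "v i \<ge> 0" if i: "i \<in> J - Y" for i
    proof (cases "f i < 0")
      case True
      then have "t * (- f i) \<le> w i"
        using tle[of i] i by (simp add: G_def pos_le_divide_eq[of "- f i"] del: divide_minus_right)
      then show ?thesis by (simp add: v_def)
    next
      case False
      then show ?thesis using t0 less.prems(4)[OF i] by (simp add: v_def)
    qed
    have lJ: "l \<in> J" "l \<notin> Y" using l by (auto simp: G_def)
    have s1: "(\<Sum>i\<in>J - {l}. v i *\<^sub>R x i) = 0"
    proof -
      have "(\<Sum>i\<in>J - {l}. v i *\<^sub>R x i) = (\<Sum>i\<in>J. v i *\<^sub>R x i)"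
        using less.prems vl by (intro sum.mono_neutral_left) auto
      also have "\<dots> = (\<Sum>i\<in>J. w i *\<^sub>R x i) + t *\<^sub>R (\<Sum>i\<in>J. f i *\<^sub>R x i)"
        by (simp add: v_def scaleR_add_left sum.distrib scaleR_sum_right)
      finally show ?thesis using f less.prems by simp
    qed
    have s2: "(\<Sum>i\<in>J - {l}. v i) > 0"
    proof -
      have "(\<Sum>i\<in>J - {l}. v i) = (\<Sum>i\<in>J. v i)"
        using less.prems vl by (intro sum.mono_neutral_left) auto
      also have "\<dots> = (\<Sum>i\<in>J. w i) + t * (\<Sum>i\<in>J. f i)"
        by (simp add: v_def sum.distrib sum_distrib_left)
      finally show ?thesis using f less.prems by simp
    qed
    have "\<exists>F d. Y \<subseteq> F \<and> F \<subseteq> J - {l} \<and> card F = 3 \<and> (\<Sum>i\<in>F. d i *\<^sub>R x i) = 0 \<and>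
           (\<forall>i\<in>F - Y. d i \<ge> 0) \<and> (\<Sum>i\<in>F. d i) > (0::real)"
      by (rule less.hyps[of "J - {l}" v]) (use less.prems False lJ s1 s2 v0 in auto)
    then show ?thesis by (meson Diff_subset order_trans)
  qed
qed

section \<open>The Steinitz constant of the Euclidean plane\<close>

text \<open>Vectors are removed one at a time and every remaining sum is bounded. Reading the
  removals backwards gives an ordering with partial sums of norm at most
  \<open>sqrt 5 / 2\<close>.\<close>

inductive orderable :: "('i \<Rightarrow> 'a::real_inner) \<Rightarrow> 'i set \<Rightarrow> bool" for x where
  empty: "orderable x {}"
| insert: "i \<in> A \<Longrightarrow> orderable x (A - {i}) \<Longrightarrow> (norm (sum x A))\<^sup>2 \<le> 5 / 4 \<Longrightarrow> orderable x A"

text \<open>The invariant of the removal process. The first alternative covers the empty set, which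
  offers no \<open>y\<close>.\<close>

definition near_segment :: "('i \<Rightarrow> 'a::real_inner) \<Rightarrow> 'i set \<Rightarrow> bool" where
  "near_segment x A \<longleftrightarrow>
     norm (sum x A) \<le> 1 / 2 \<or> (\<exists>y\<in>A. \<exists>c\<in>{0..1}. norm (sum x A - c *\<^sub>R x y) \<le> 1 / 2)"

section \<open>The induction step: safe removals\<close>

text \<open>When several vectors are removed in a row, only the final set must satisfy the
  invariant; the intermediate sums need just the norm bound.\<close>

locale ordering_step =
  fixes x :: "'i \<Rightarrow> 'a::euclidean_space" and A :: "'i set"
  assumes dim2: "DIM('a) = 2"
    and finite_A: "finite A"
    and norm_le_1: "\<And>i. i \<in> A \<Longrightarrow> norm (x i) \<le> 1"
    and norm_sum: "(norm (sum x A))\<^sup>2 \<le> 5 / 4"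
    and IH: "\<And>B. B \<subset> A \<Longrightarrow> (norm (sum x B))\<^sup>2 \<le> 5 / 4 \<Longrightarrow> near_segment x B \<Longrightarrow> orderable x B"
begin

definition T :: 'a where "T = sum x A"

lemma norm_T: "(norm T)\<^sup>2 \<le> 5 / 4"
  using norm_sum by (simp add: T_def)

lemma sum_remove1: "a \<in> A \<Longrightarrow> sum x (A - {a}) = T - x a"
  using finite_A by (simp add: sum_diff1 T_def)

lemma sum_remove2: "a \<in> A \<Longrightarrow> b \<in> A \<Longrightarrow> a \<noteq> b \<Longrightarrow> sum x (A - {a} - {b}) = T - x a - x b"
  using finite_A by (simp add: sum_diff1 T_def)

lemma sum_remove3:
  "a \<in> A \<Longrightarrow> b \<in> A \<Longrightarrow> e \<in> A \<Longrightarrow> a \<noteq> b \<Longrightarrow> a \<noteq> e \<Longrightarrow> b \<noteq> e \<Longrightarrow>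
    sum x (A - {a} - {b} - {e}) = T - x a - x b - x e"
  using finite_A by (simp add: sum_diff1 T_def)

lemma small_sq: "norm (v::'a) \<le> 1 / 2 \<Longrightarrow> (norm v)\<^sup>2 \<le> 5 / 4"
  using power_mono[of "norm v" "1/2" 2] by (simp add: power2_eq_square)

lemma le1_sq: "norm (v::'a) \<le> 1 \<Longrightarrow> (norm v)\<^sup>2 \<le> 5 / 4"
  using power_mono[of "norm v" 1 2] by simp

lemma orderable_A: "a \<in> A \<Longrightarrow> orderable x (A - {a}) \<Longrightarrow> orderable x A"
  using orderable.insert[of a A x] norm_T by (simp add: T_def)

lemma orderable_remove2:
  assumes "a \<in> A" "b \<in> A" "a \<noteq> b" "(norm (T - x a))\<^sup>2 \<le> 5 / 4" "orderable x (A - {a} - {b})"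
  shows "orderable x A"
  by (rule orderable_A[OF assms(1)], rule orderable.insert[of b])
     (use assms sum_remove1 in auto)

lemma near_remove1:
  assumes "a \<in> A" "b \<in> A" "a \<noteq> b" "0 \<le> c" "c \<le> 1" "(norm (T - x a))\<^sup>2 \<le> 5 / 4"
    "norm (T - x a - c *\<^sub>R x b) \<le> 1 / 2"
  shows "orderable x (A - {a})"
  by (rule IH) (use assms sum_remove1 in \<open>auto simp: near_segment_def\<close>)

lemma near_remove2:
  assumes "a \<in> A" "b \<in> A" "e \<in> A" "a \<noteq> b" "a \<noteq> e" "b \<noteq> e" "0 \<le> c" "c \<le> 1"
    "(norm (T - x a - x b))\<^sup>2 \<le> 5 / 4" "norm (T - x a - x b - c *\<^sub>R x e) \<le> 1 / 2"
  shows "orderable x (A - {a} - {b})"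
  by (rule IH) (use assms sum_remove2 in \<open>auto simp: near_segment_def\<close>)

lemma small_remove2:
  assumes "a \<in> A" "b \<in> A" "a \<noteq> b" "norm (T - x a - x b) \<le> 1 / 2"
  shows "orderable x (A - {a} - {b})"
  by (rule IH) (use assms sum_remove2 small_sq in \<open>auto simp: near_segment_def\<close>)

lemma small_remove3:
  assumes "a \<in> A" "b \<in> A" "e \<in> A" "a \<noteq> b" "a \<noteq> e" "b \<noteq> e"
    "norm (T - x a - x b - x e) \<le> 1 / 2"
  shows "orderable x (A - {a} - {b} - {e})"
  by (rule IH) (use assms sum_remove3 small_sq in \<open>auto simp: near_segment_def\<close>)

lemma scaled_le:
  assumes "a \<in> A" "0 \<le> c" "c \<le> d" shows "norm (c *\<^sub>R x a) \<le> d"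
proof -
  have "c * norm (x a) \<le> d * 1" using assms norm_le_1 by (intro mult_mono) auto
  then show ?thesis using assms by simp
qed

lemma scaled_half: "a \<in> A \<Longrightarrow> 0 \<le> c \<Longrightarrow> c \<le> 1 / 2 \<Longrightarrow> norm (c *\<^sub>R x a) \<le> 1 / 2"
  by (rule scaled_le)

text \<open>If removing both \<open>a\<close> and \<open>b\<close> misses radius 1/2, rounding shows
  that removing \<open>a\<close> alone is safe. Otherwise both go, and one of the two intermediate
  sums must be bounded: either removing \<open>y\<close> is safe, or rounding gives
  \<open>norm T \<le> 1 / 2\<close> and the parallelogram bound applies.\<close>

lemma orderable_two_step:
  assumes ab: "a \<in> A" "b \<in> A" "a \<noteq> b" and T1: "T = h' + x a + \<beta> *\<^sub>R x b" and h': "norm h' \<le> 1 / 2"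
    and \<beta>: "0 \<le> \<beta>" "\<beta> \<le> 1"
    and y: "y = a \<or> y = b" and T0: "T = h + \<kappa> *\<^sub>R x y" and h: "norm h \<le> 1 / 2" and \<kappa>: "0 \<le> \<kappa>" "\<kappa> \<le> 1"
  shows "orderable x A"
proof (cases "norm (T - x a - x b) > 1 / 2")
  case True
  have "T - x a - x b = h' - (1 - \<beta>) *\<^sub>R x b" using T1 by (simp add: algebra_simps)
  then have "(norm (h' + \<beta> *\<^sub>R x b))\<^sup>2 \<le> 5 / 4"
    using rounding_up_bound[OF \<beta> norm_le_1[OF ab(2)] h'] True by simp
  moreover have "T - x a = h' + \<beta> *\<^sub>R x b" using T1 by simp
  ultimately show ?thesis
    using orderable_A[OF ab(1)] near_remove1[OF ab \<beta>] h' by simp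
next
  case False
  then have u: "norm (T - x a - x b) \<le> 1 / 2" "norm (T - x b - x a) \<le> 1 / 2"
    by (simp_all add: algebra_simps)
  have o: "orderable x (A - {a} - {b})" "orderable x (A - {b} - {a})"
    using small_remove2 ab u by auto
  have yA: "y \<in> A" using y ab by auto
  have "(norm (T - x a))\<^sup>2 \<le> 5 / 4 \<or> (norm (T - x b))\<^sup>2 \<le> 5 / 4"
  proof (cases "(norm (T - x y))\<^sup>2 \<le> 5 / 4")
    case True then show ?thesis using y by auto
  next
    case False
    have "T - x y = h - (1 - \<kappa>) *\<^sub>R x y" using T0 by (simp add: algebra_simps)
    then have "norm (h + \<kappa> *\<^sub>R x y) \<le> 1 / 2"
      using rounding_down_bound[OF \<kappa> norm_le_1[OF yA] h] False by simp
    then show ?thesis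
      using parallelogram_corner_bound[of "x a" "x b" T] norm_le_1 ab u T0 by simp
  qed
  then show ?thesis using orderable_remove2 ab o by metis
qed

text \<open>Triangle inequality: what remains is \<open>\<beta> x b - (1 - \<alpha>) x a\<close>, of
  norm at most \<open>\<beta> + (1 - \<alpha>)\<close>.\<close>

lemma norm_remove_larger:
  assumes ab: "a \<in> A" "b \<in> A" and V: "V = \<alpha> *\<^sub>R x a + \<beta> *\<^sub>R x b" and "0 \<le> \<beta>" "\<beta> \<le> \<alpha>" "\<alpha> \<le> 1"
  shows "(norm (V - x a))\<^sup>2 \<le> 5 / 4"
proof -
  have "V - x a = \<beta> *\<^sub>R x b - (1 - \<alpha>) *\<^sub>R x a" using V by (simp add: algebra_simps)
  then have "norm (V - x a) \<le> norm (\<beta> *\<^sub>R x b) + norm ((1 - \<alpha>) *\<^sub>R x a)"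
    using norm_triangle_ineq4 by metis
  also have "\<dots> \<le> \<beta> + (1 - \<alpha>)" using assms by (intro add_mono scaled_le) auto
  also have "\<dots> \<le> 1" using assms by simp
  finally show ?thesis by (rule le1_sq)
qed

lemma residue_norm:
  assumes "a \<in> A" and "V = \<alpha> *\<^sub>R x a + W" "1 / 2 \<le> \<alpha>" "\<alpha> \<le> 1"
  shows "norm (V - x a - W) \<le> 1 / 2"
proof -
  have "V - x a - W = - ((1 - \<alpha>) *\<^sub>R x a)" using assms by (simp add: algebra_simps)
  then show ?thesis using scaled_le[of a "1 - \<alpha>" "1/2"] assms by (simp del: norm_scaleR)
qed

text \<open>Removing the vector with the larger coefficient respects the norm bound, and since
  \<open>1 - \<alpha>\<close> is at most 1/2 the rest lies near the segment of
  \<open>b\<close>.\<close>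

lemma orderable_pair:
  assumes ab: "a \<in> A" "b \<in> A" "a \<noteq> b" and T: "T = \<alpha> *\<^sub>R x a + \<beta> *\<^sub>R x b" and "0 \<le> \<beta>" "\<beta> \<le> \<alpha>" "\<alpha> \<le> 1" "1 / 2 \<le> \<alpha>"
  shows "orderable x A"
  by (rule orderable_A[OF ab(1)], rule near_remove1[of a b \<beta>])
     (use assms norm_remove_larger residue_norm in auto)

text \<open>Without \<open>a\<close> a pair is left; its larger member is removed next, and what
  remains is near the segment of the other one.\<close>

lemma orderable_remove_to_pair:
  assumes mem: "a \<in> A" "b \<in> A" "e \<in> A" "a \<noteq> b" "a \<noteq> e" "b \<noteq> e"
    and T: "T = x a + \<beta> *\<^sub>R x b + \<epsilon> *\<^sub>R x e" and c: "1 / 2 \<le> \<beta>" "\<beta> \<le> 1" "1 / 2 \<le> \<epsilon>" "\<epsilon> \<le> 1"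
    and n: "(norm (T - x a))\<^sup>2 \<le> 5 / 4"
  shows "orderable x A"
proof -
  have *: "orderable x A" if mem: "b \<in> A" "e \<in> A" "a \<noteq> b" "a \<noteq> e" "b \<noteq> e" 
    and T: "T = x a + \<beta> *\<^sub>R x b + \<epsilon> *\<^sub>R x e" and c: "1 / 2 \<le> \<beta>" "\<beta> \<le> 1" "1 / 2 \<le> \<epsilon>" "\<epsilon> \<le> 1"
    and le: "\<epsilon> \<le> \<beta>" for b e \<beta> \<epsilon>
  proof -
    have V: "T - x a = \<beta> *\<^sub>R x b + \<epsilon> *\<^sub>R x e" using T by simp
    have "orderable x (A - {a} - {b})"
      by (rule near_remove2[of a b e \<epsilon>])
        (use that assms(1) norm_remove_larger[OF mem(1,2) V] residue_norm[OF mem(1) V] in auto)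
    then show ?thesis using orderable_remove2 mem n assms(1) by blast
  qed
  show ?thesis
  proof (cases "\<epsilon> \<le> \<beta>")
    case True
    then show ?thesis using *[of b e \<beta> \<epsilon>] assms by auto
  next
    case False
    then show ?thesis using *[of e b \<epsilon> \<beta>] assms by (auto simp: algebra_simps)
  qed
qed

text \<open>The two vectors in question round the coefficient of \<open>b\<close> in a combination whose fractional
  value \<open>-(1 - k) x a\<close> has norm at most one.\<close>

lemma round_second:
  assumes "a \<in> A" "b \<in> A" and T: "T = k *\<^sub>R x a + l *\<^sub>R x b" and "0 \<le> k" "k \<le> 1" "0 \<le> l" "l \<le> 1"
    and "\<not> (norm (T - x a))\<^sup>2 \<le> 5 / 4"
  shows "(norm (T - x a - x b))\<^sup>2 \<le> 5 / 4"
proof (rule ccontr)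
  assume neg: "\<not> (norm (T - x a - x b))\<^sup>2 \<le> 5 / 4"
  define h where "h = - ((1 - k) *\<^sub>R x a)"
  have h: "norm h \<le> 1" using scaled_le[of a "1 - k" 1] assms unfolding h_def by (simp del: norm_scaleR)
  have eq: "T - x a = h + l *\<^sub>R x b" "T - x a - x b = h - (1 - l) *\<^sub>R x b"
    using T by (simp_all add: h_def algebra_simps)
  have hh: "(norm h)\<^sup>2 \<le> 1" using h by (simp add: abs_square_le_1)
  \<comment> \<open>The weighted mean of the two squares is at most 1 + 1/4, so they cannot both
    exceed 5/4.\<close>
  have "l * (1 - l) \<le> 1 / 4" using zero_le_square[of "l - 1/2"] by (simp add: algebra_simps)
  then have "(1 - l) * (norm (h + l *\<^sub>R x b))\<^sup>2 + l * (norm (h - (1 - l) *\<^sub>R x b))\<^sup>2 \<le> 5 / 4"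
    using rounding_bound[OF assms(6,7) norm_le_1[OF assms(2)], of h] hh by linarith
  moreover have P: "5 / 4 < (norm (h + l *\<^sub>R x b))\<^sup>2" and Q: "5 / 4 < (norm (h - (1 - l) *\<^sub>R x b))\<^sup>2"
    using neg assms(8) unfolding eq(1)[symmetric] eq(2)[symmetric] by linarith+
  have "(1 - l) * (5 / 4) \<le> (1 - l) * (norm (h + l *\<^sub>R x b))\<^sup>2"
    using P assms by (intro mult_left_mono) auto
  moreover have "l * (5 / 4) \<le> l * (norm (h - (1 - l) *\<^sub>R x b))\<^sup>2"
    using Q assms by (intro mult_left_mono) auto
  moreover have "l = 0 \<or> l * (5 / 4) < l * (norm (h - (1 - l) *\<^sub>R x b))\<^sup>2"
    using mult_strict_left_mono[OF Q, of l] assms(6) by linarith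
  moreover have "(1 - l) * (5 / 4) = 5 / 4 - l * (5 / 4)" by (simp add: field_simps)
  ultimately show False using P by (elim disjE) (simp, linarith)
qed

text \<open>In the next two lemmas a pair representation of \<open>T\<close> has been moved along a line until the
  coefficient of \<open>a\<close> reached one. Here \<open>a\<close> is the newcomer, afterwards it is a member of the pair.\<close>

lemma orderable_triple_new:
  assumes mem: "a \<in> A" "b \<in> A" "e \<in> A" "a \<noteq> b" "a \<noteq> e" "b \<noteq> e"
    and T1: "T = x a + \<beta> *\<^sub>R x b + \<epsilon> *\<^sub>R x e" and c: "0 \<le> \<beta>" "\<beta> \<le> 1" "0 \<le> \<epsilon>" "\<epsilon> \<le> 1"
    and T0: "T = k *\<^sub>R x b + l *\<^sub>R x e" and k: "0 \<le> k" "k \<le> 1 / 2" "0 \<le> l" "l \<le> 1 / 2"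
  shows "orderable x A"
proof -
  consider "\<beta> \<le> 1/2" | "\<epsilon> \<le> 1/2" | "\<beta> \<ge> 1/2" "\<epsilon> \<ge> 1/2" "(norm (T - x a))\<^sup>2 \<le> 5 / 4"
    | "\<beta> > 1/2" "\<epsilon> > 1/2" by linarith
  then show ?thesis
  proof cases
    case 1
    \<comment> \<open>The multiples of \<open>x b\<close> are short enough to serve as the errors
      \<open>h'\<close> and \<open>h\<close> of the two-step lemma.\<close>
    show ?thesis
      by (rule orderable_two_step[of a e "\<beta> *\<^sub>R x b" \<epsilon> e "k *\<^sub>R x b" l])
         (use 1 assms scaled_half in \<open>auto simp: add.commute simp del: norm_scaleR\<close>)
  next
    case 2
    show ?thesis
      by (rule orderable_two_step[of a b "\<epsilon> *\<^sub>R x e" \<beta> b "l *\<^sub>R x e" k])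
         (use 2 assms scaled_half in \<open>auto simp: add.commute simp del: norm_scaleR\<close>)
  next
    case 3
    then show ?thesis using orderable_remove_to_pair assms by blast
  next
    case 4
    \<comment> \<open>By symmetry \<open>l \<le> k\<close>, so removing \<open>b\<close> first is
      safe. The removal orders considered are \<open>b, a\<close>, then \<open>e, a\<close>, then
      \<open>b, e, a\<close>.\<close>
    have *: "orderable x A" if mem: "b \<in> A" "e \<in> A" "a \<noteq> b" "a \<noteq> e" "b \<noteq> e" 
      and T1: "T = x a + \<beta> *\<^sub>R x b + \<epsilon> *\<^sub>R x e" and c: "1 / 2 < \<beta>" "\<beta> \<le> 1" "1 / 2 < \<epsilon>" "\<epsilon> \<le> 1"
      and T0: "T = k *\<^sub>R x b + l *\<^sub>R x e" and k: "0 \<le> l" "l \<le> k" "k \<le> 1 / 2" for b e \<beta> \<epsilon> k l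
    proof -
      have Tb: "(norm (T - x b))\<^sup>2 \<le> 5 / 4"
        by (rule norm_remove_larger[of b e _ k l]) (use that in auto)
      have V: "T - x a = \<beta> *\<^sub>R x b + \<epsilon> *\<^sub>R x e" using T1 by simp
      have comm: "A - {a} - {b} = A - {b} - {a}" "A - {a} - {e} = A - {e} - {a}" by auto
      have oab: "orderable x (A - {a} - {b})" if "(norm (T - x a - x b))\<^sup>2 \<le> 5 / 4"
        by (rule near_remove2[of a b e \<epsilon>])
           (use mem c that assms(1) residue_norm[OF mem(1) V] in auto)
      have oab': "orderable x A" if "(norm (T - x a - x b))\<^sup>2 \<le> 5 / 4"
        using orderable_remove2[OF mem(1) assms(1)] mem Tb oab[OF that] comm by auto
      show ?thesis
      proof (cases "\<epsilon> \<le> \<beta>")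
        case True
        show ?thesis
          by (rule oab', rule norm_remove_larger[OF mem(1,2) V]) (use True c in auto)
      next
        case False
        have V': "T - x a = \<epsilon> *\<^sub>R x e + \<beta> *\<^sub>R x b" using V by simp
        have oae: "orderable x (A - {a} - {e})"
          by (rule near_remove2[of a e b \<beta>])
             (use mem c False assms(1) norm_remove_larger[OF mem(2,1) V'] residue_norm[OF mem(2) V'] in auto)
        show ?thesis
        proof (cases "(norm (T - x e))\<^sup>2 \<le> 5 / 4")
          case True
          then show ?thesis using orderable_remove2[OF mem(2) assms(1)] mem oae comm by auto
        next
          case not_e: False
          have "(norm (T - x e - x b))\<^sup>2 \<le> 5 / 4"
            by (rule round_second[of e b l k]) (use T0 mem k not_e in \<open>auto simp: add.commute\<close>)
          then have Tbe: "(norm (T - x b - x e))\<^sup>2 \<le> 5 / 4" by (simp add: algebra_simps)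
          \<comment> \<open>If removing all three misses radius 1/2, rounding the coefficient of
            \<open>e\<close> bounds \<open>T - x a - x b\<close> and the order \<open>b, a\<close>
            works; otherwise \<open>b, e, a\<close> ends at a short sum.\<close>
          define h where "h = - ((1 - \<beta>) *\<^sub>R x b)"
          have h: "norm h \<le> 1/2" using scaled_le[of b "1 - \<beta>" "1/2"] that unfolding h_def by (simp del: norm_scaleR)
          have u: "T - x a - x b - x e = h - (1 - \<epsilon>) *\<^sub>R x e" "T - x a - x b = h + \<epsilon> *\<^sub>R x e"
            using T1 by (simp_all add: h_def algebra_simps)
          show ?thesis
          proof (cases "norm (T - x a - x b - x e) > 1/2")
            case True
            have "(norm (T - x a - x b))\<^sup>2 \<le> 5 / 4"
              unfolding u(2)
              by (rule rounding_up_bound) (use c norm_le_1 mem h True u(1) in auto)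
            then show ?thesis by (rule oab')
          next
            case False
            then have "norm (T - x b - x e - x a) \<le> 1/2" by (simp add: algebra_simps)
            then have o3: "orderable x (A - {b} - {e} - {a})" using small_remove3 mem assms(1) by metis
            have "orderable x (A - {b} - {e})"
              by (rule orderable.insert[of a]) (use o3 sum_remove2 mem assms(1) Tbe in auto)
            then show ?thesis using orderable_remove2[OF mem(1,2)] mem Tb by auto
          qed
        qed
      qed
    qed
    show ?thesis
    proof (cases "l \<le> k")
      case True
      then show ?thesis using *[of b e \<beta> \<epsilon> k l] assms 4 by auto
    next
      case False
      then show ?thesis using *[of e b \<epsilon> \<beta> l k] assms 4 by (auto simp: algebra_simps)
    qed
  qed
qed

lemma orderable_triple_old:
  assumes mem: "a \<in> A" "b \<in> A" "e \<in> A" "a \<noteq> b" "a \<noteq> e" "b \<noteq> e"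
    and T1: "T = x a + \<beta> *\<^sub>R x b + \<epsilon> *\<^sub>R x e" and c: "0 \<le> \<beta>" "\<beta> \<le> 1" "0 \<le> \<epsilon>" "\<epsilon> \<le> 1"
    and T0: "T = k *\<^sub>R x a + l *\<^sub>R x b" and k: "0 \<le> k" "k \<le> 1 / 2" "0 \<le> l" "l \<le> 1 / 2"
  shows "orderable x A"
proof -
  consider "\<beta> \<le> 1/2" | "\<epsilon> \<le> 1/2" | "\<beta> \<ge> 1/2" "\<epsilon> \<ge> 1/2" "(norm (T - x a))\<^sup>2 \<le> 5 / 4"
    | "\<beta> > 1/2" "\<epsilon> > 1/2" "\<not> (norm (T - x a))\<^sup>2 \<le> 5 / 4" by linarith
  then show ?thesis
  proof cases
    case 1
    show ?thesis
      by (rule orderable_two_step[of a e "\<beta> *\<^sub>R x b" \<epsilon> a "l *\<^sub>R x b" k])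
         (use 1 assms scaled_half in \<open>auto simp: add.commute simp del: norm_scaleR\<close>)
  next
    case 2
    show ?thesis
      by (rule orderable_two_step[of a b "\<epsilon> *\<^sub>R x e" \<beta> a "l *\<^sub>R x b" k])
         (use 2 assms scaled_half in \<open>auto simp: add.commute simp del: norm_scaleR\<close>)
  next
    case 3
    then show ?thesis using orderable_remove_to_pair assms by blast
  next
    case 4
    \<comment> \<open>With \<open>l \<le> k\<close>, removing \<open>a\<close> would be safe,
      contrary to the case. Hence \<open>b\<close> can go first, and \<open>a\<close>
      second.\<close>
    have kl: "k < l"
      using norm_remove_larger[of a b T k l] 4 assms by force
    have Tb: "(norm (T - x b))\<^sup>2 \<le> 5 / 4"
      by (rule norm_remove_larger[of b a _ l k]) (use T0 mem k kl in \<open>auto simp: add.commute\<close>)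
    have Tab: "(norm (T - x a - x b))\<^sup>2 \<le> 5 / 4"
      by (rule round_second[of a b k l]) (use assms 4 in auto)
    have V: "T - x a = \<beta> *\<^sub>R x b + \<epsilon> *\<^sub>R x e" using T1 by simp
    have "orderable x (A - {a} - {b})"
      by (rule near_remove2[of a b e \<epsilon>]) (use assms 4 Tab residue_norm[OF mem(2) V] in auto)
    moreover have "A - {a} - {b} = A - {b} - {a}" by auto
    ultimately show ?thesis using orderable_remove2[OF mem(2,1)] mem Tb by auto
  qed
qed

end

section \<open>Geometry of a shortest error vector\<close>

lemma parallel_if_orthogonal_to_same:
  fixes y h v :: "'a::euclidean_space"
  assumes dim: "DIM('a) = 2" and "y \<noteq> 0" "h \<noteq> 0" "y \<bullet> h = 0" "v \<bullet> h = 0"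
  obtains \<alpha> where "v = \<alpha> *\<^sub>R y"
proof -
  define V where "V = (\<lambda>n::nat. if n = 0 then y else if n = 1 then h else v)"
  obtain e where e: "\<exists>j\<in>{0,1,2}. e j \<noteq> 0" "(\<Sum>j\<in>{0,1,2}. e j *\<^sub>R V j) = 0"
    by (rule linear_dependence_of_family[of "{0,1,2::nat}" V]) (use dim in auto)
  have eq: "e 0 *\<^sub>R y + e 1 *\<^sub>R h + e 2 *\<^sub>R v = 0"
    using e(2) by (simp add: V_def add.assoc)
  have "(e 0 *\<^sub>R y + e 1 *\<^sub>R h + e 2 *\<^sub>R v) \<bullet> h = 0" unfolding eq by simp
  then have e1: "e 1 = 0" using assms by (simp add: inner_add_left)
  have e2: "e 2 \<noteq> 0"
  proof
    assume "e 2 = 0"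
    then show False using eq e1 e(1) assms by simp
  qed
  have "e 2 *\<^sub>R v = - (e 0 *\<^sub>R y)" using eq e1 by (simp add: add_eq_0_iff)
  then have "inverse (e 2) *\<^sub>R e 2 *\<^sub>R v = inverse (e 2) *\<^sub>R (- (e 0 *\<^sub>R y))" by simp
  then have "v = (- e 0 / e 2) *\<^sub>R y" using e2 by (simp add: divide_inverse_commute)
  then show ?thesis by (rule that)
qed

text \<open>If \<open>h \<bullet> v\<close> were positive, the step
  \<open>min r (h \<bullet> v)\<close> would be short enough for the linear gain to outweigh the
  quadratic loss, making \<open>h\<close> shorter.\<close>

lemma inner_nonpos_if_nearest:
  fixes h v :: "'a::real_inner"
  assumes v: "norm v \<le> 1" and r: "r > 0" and min: "\<And>\<delta>. 0 \<le> \<delta> \<Longrightarrow> \<delta> \<le> r \<Longrightarrow> norm h \<le> norm (h - \<delta> *\<^sub>R v)"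
  shows "h \<bullet> v \<le> 0"
proof (rule ccontr)
  assume "\<not> ?thesis"
  then have s: "h \<bullet> v > 0" by simp
  define \<delta> where "\<delta> = min r (h \<bullet> v)"
  have \<delta>: "0 < \<delta>" "\<delta> \<le> r" "\<delta> \<le> h \<bullet> v" using s r by (auto simp: \<delta>_def)
  have "(norm h)\<^sup>2 \<le> (norm (h - \<delta> *\<^sub>R v))\<^sup>2" using min[of \<delta>] \<delta> by (intro power_mono) auto
  also have "\<dots> = (norm h)\<^sup>2 - 2 * \<delta> * (h \<bullet> v) + \<delta> * \<delta> * (norm v)\<^sup>2"
    unfolding power2_norm_eq_inner
    by (simp add: inner_diff_left inner_diff_right inner_commute[of v h] algebra_simps)
  also have "\<delta> * \<delta> * (norm v)\<^sup>2 \<le> \<delta> * \<delta> * 1"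
    using v \<delta> by (intro mult_left_mono) (auto simp: abs_square_le_1)
  also have "\<delta> * \<delta> \<le> \<delta> * (h \<bullet> v)" using \<delta> by (intro mult_left_mono) auto
  finally have "\<delta> * (h \<bullet> v) \<le> 0" by simp
  then show False using s \<delta> by (simp add: mult_le_0_iff)
qed

section \<open>Extremal pair representations\<close>

context ordering_step
begin

text \<open>For each of the finitely many index pairs the admissible coefficients form a compact
  set, so the coefficient sum attains its maximum.\<close>

lemma obtain_maximal_pair:
  assumes "a \<in> A" "b \<in> A" "a \<noteq> b" "T = k *\<^sub>R x a + l *\<^sub>R x b" "0 \<le> k" "k \<le> 1" "0 \<le> l" "l \<le> 1"
  obtains i j k l where "i \<in> A" "j \<in> A" "i \<noteq> j" "T = k *\<^sub>R x i + l *\<^sub>R x j" "0 \<le> k" "k \<le> 1" "0 \<le> l" "l \<le> 1"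
    "\<And>i' j' k' l'. i' \<in> A \<Longrightarrow> j' \<in> A \<Longrightarrow> i' \<noteq> j' \<Longrightarrow> T = k' *\<^sub>R x i' + l' *\<^sub>R x j' \<Longrightarrow>
       0 \<le> k' \<Longrightarrow> k' \<le> 1 \<Longrightarrow> 0 \<le> l' \<Longrightarrow> l' \<le> 1 \<Longrightarrow> k' + l' \<le> k + l"
proof -
  define D where "D = (\<lambda>(i,j). {0..1::real} \<times> {0..1::real} \<inter>
      (\<lambda>(k,l). k *\<^sub>R x i + l *\<^sub>R x j) -` {T})"
  define P where "P = {(i,j). i \<in> A \<and> j \<in> A \<and> i \<noteq> j}"
  define C where "C = (\<Union>p\<in>P. (\<lambda>(k,l). k + l) ` D p)"
  have "finite P" by (rule finite_subset[of _ "A \<times> A"]) (auto simp: P_def finite_A)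
  moreover have "compact ((\<lambda>(k::real,l). k + l) ` D p)" for p
  proof (rule compact_continuous_image)
    show "continuous_on (D p) (\<lambda>(k::real,l). k + l)"
      by (auto simp: case_prod_unfold intro!: continuous_intros)
    have "closed ((\<lambda>(k,l). k *\<^sub>R x (fst p) + l *\<^sub>R x (snd p)) -` {T})"
      by (rule closed_vimage) (auto simp: case_prod_unfold intro!: continuous_intros)
    then show "compact (D p)"
      unfolding D_def by (cases p) (auto intro!: compact_Int_closed compact_Times)
  qed
  ultimately have "compact C" unfolding C_def by (intro compact_UN) auto
  moreover have "k + l \<in> C" using assms by (force simp: C_def P_def D_def)
  ultimately obtain s where s: "s \<in> C" "\<And>t. t \<in> C \<Longrightarrow> t \<le> s"
    using compact_attains_sup[of C] by blast
  from s(1) obtain i j where "(i,j) \<in> P" "s \<in> (\<lambda>(k,l). k + l) ` D (i,j)"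
    unfolding C_def by force
  then obtain q where q: "i \<in> A" "j \<in> A" "i \<noteq> j" "q \<in> D (i,j)" "s = fst q + snd q"
    unfolding P_def by auto
  define k l where "k = fst q" and "l = snd q"
  have ij: "i \<in> A" "j \<in> A" "i \<noteq> j" "T = k *\<^sub>R x i + l *\<^sub>R x j"
      "0 \<le> k" "k \<le> 1" "0 \<le> l" "l \<le> 1" and sk: "s = k + l"
    using q by (auto simp: D_def k_def l_def)
  show ?thesis
  proof (rule that[OF ij])
    fix i' j' k' l'
    assume "i' \<in> A" "j' \<in> A" "i' \<noteq> j'" "T = k' *\<^sub>R x i' + l' *\<^sub>R x j'"
       "0 \<le> k'" "k' \<le> 1" "0 \<le> l'" "l' \<le> 1"
    then have "k' + l' \<in> C" by (force simp: C_def P_def D_def)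
    then show "k' + l' \<le> k + l" using s(2) sk by blast
  qed
qed

text \<open>Indices and coefficients are packed into one object, so that a representation optimal in
  two respects can be selected at once.\<close>

definition representation :: "('i \<times> 'i) \<times> (real \<times> real) \<Rightarrow> bool" where
  "representation = (\<lambda>((i,j),(k,l)). i \<in> A \<and> j \<in> A \<and> i \<noteq> j \<and> T = k *\<^sub>R x i + l *\<^sub>R x j \<and>
      0 \<le> k \<and> k \<le> 1 \<and> 0 \<le> l \<and> l \<le> 1)"

lemma representation_iff: "representation ((i,j),(k,l)) \<longleftrightarrow> i \<in> A \<and> j \<in> A \<and> i \<noteq> j \<and>
    T = k *\<^sub>R x i + l *\<^sub>R x j \<and> 0 \<le> k \<and> k \<le> 1 \<and> 0 \<le> l \<and> l \<le> 1"
  by (simp add: representation_def)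

lemma orderable_large_pair:
  assumes rep: "representation ((i,j),(k,l))" and large: "k \<ge> 1/2 \<or> l \<ge> 1/2"
  shows "orderable x A"
proof (cases "l \<le> k")
  case True
  show ?thesis
    by (rule orderable_pair[of i j k l])
       (use rep large True in \<open>simp_all add: representation_iff, linarith\<close>)
next
  case False
  have "T = l *\<^sub>R x j + k *\<^sub>R x i" using rep by (simp add: representation_iff add.commute)
  then show ?thesis
    by (rule orderable_pair[of j i l k, rotated 3])
       (use rep large False in \<open>auto simp: representation_iff\<close>)
qed

text \<open>Among the representations with maximal coefficient sum, one with the fewest nonzero
  coefficients is taken. A relation among the vectors actually used could be followed, without
  lowering the sum, until a coefficient vanishes or reaches 1; the first contradicts minimality and
  the second makes \<open>A\<close> orderable.\<close>

lemma obtain_independent_pair: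
  assumes rep: "representation r0" and small: "\<not> orderable x A"
  obtains i j k l where "representation ((i,j),(k,l))"
    "\<And>i' j' k' l'. representation ((i',j'),(k',l')) \<Longrightarrow> k' + l' \<le> k + l"
    "\<And>f. (k = 0 \<longrightarrow> f i = 0) \<Longrightarrow> (l = 0 \<longrightarrow> f j = 0) \<Longrightarrow> f i *\<^sub>R x i + f j *\<^sub>R x j = 0 \<Longrightarrow> f i = (0::real) \<and> f j = 0"
proof -
  obtain a b k0 l0 where r0: "r0 = ((a,b),(k0,l0))" by (cases r0, cases "fst r0") auto
  define M where "M r \<longleftrightarrow> representation r \<and>
      (\<forall>i j k l. representation ((i,j),(k,l)) \<longrightarrow> k + l \<le> fst (snd r) + snd (snd r))" for r
  have ab: "a \<in> A" "b \<in> A" "a \<noteq> b" "T = k0 *\<^sub>R x a + l0 *\<^sub>R x b" "0 \<le> k0" "k0 \<le> 1" "0 \<le> l0" "l0 \<le> 1"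
    using rep unfolding r0 representation_iff by blast+
  have "\<exists>r. M r"
  proof (rule obtain_maximal_pair[OF ab])
    fix i j k l
    assume "i \<in> A" "j \<in> A" "i \<noteq> j" "T = k *\<^sub>R x i + l *\<^sub>R x j" "0 \<le> k" "k \<le> 1" "0 \<le> l" "l \<le> 1"
      and "\<And>i' j' k' l'. i' \<in> A \<Longrightarrow> j' \<in> A \<Longrightarrow> i' \<noteq> j' \<Longrightarrow> T = k' *\<^sub>R x i' + l' *\<^sub>R x j' \<Longrightarrow>
       0 \<le> k' \<Longrightarrow> k' \<le> 1 \<Longrightarrow> 0 \<le> l' \<Longrightarrow> l' \<le> 1 \<Longrightarrow> k' + l' \<le> k + l"
    then have "M ((i,j),(k,l))" unfolding M_def representation_iff fst_conv snd_conv by blast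
    then show ?thesis by blast
  qed
  define N where "N r = (if fst (snd r) = (0::real) then 0 else 1::nat) +
      (if snd (snd r) = (0::real) then 0 else 1::nat)" for r :: "('i \<times> 'i) \<times> (real \<times> real)"
  obtain r where r: "M r" "\<And>s. M s \<Longrightarrow> N r \<le> N s"
    using ex_has_least_nat[of M _ N] \<open>\<exists>r. M r\<close> by blast
  obtain i j k l where rr: "r = ((i,j),(k,l))" by (cases r, cases "fst r") auto
  have rep: "representation ((i,j),(k,l))" using r(1) rr by (simp add: M_def)
  then have ij: "i \<noteq> j" "i \<in> A" "j \<in> A" and T: "T = k *\<^sub>R x i + l *\<^sub>R x j"
    and kl: "0 \<le> k" "k \<le> 1" "0 \<le> l" "l \<le> 1" by (auto simp: representation_iff)
  have mx: "k' + l' \<le> k + l" if "representation ((i',j'),(k',l'))" for i' j' k' l'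
    using r(1) that unfolding M_def rr fst_conv snd_conv by blast
  have "\<not> (k \<ge> 1/2 \<or> l \<ge> 1/2)" using orderable_large_pair[OF rep] small by blast
  then have lt: "k < 1/2" "l < 1/2" by auto
  have False if f: "k = 0 \<longrightarrow> f i = 0" "l = 0 \<longrightarrow> f j = 0" "f i *\<^sub>R x i + f j *\<^sub>R x j = 0" and
      ne: "f i \<noteq> 0 \<or> f j \<noteq> 0" and pos: "f i + f j \<ge> 0" for f :: "'i \<Rightarrow> real"
  proof -
    define \<kappa> where "\<kappa> = (\<lambda>p. if p = i then k else l)"
    have \<kappa>: "\<kappa> i = k" "\<kappa> j = l" using ij by (auto simp: \<kappa>_def)
    obtain t p where t: "t > 0" "\<And>q. q \<in> {i,j} \<Longrightarrow> 0 \<le> \<kappa> q + t * f q \<and> \<kappa> q + t * f q \<le> 1"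
      "p \<in> {i,j}" "\<kappa> p + t * f p = 1 \<and> f p > 0 \<or> \<kappa> p + t * f p = 0 \<and> f p < 0"
    proof (rule ray_to_boundary[of "{i,j}" f \<kappa>])
      show "\<kappa> q < 1" if "q \<in> {i,j}" for q using that lt \<kappa> by auto
      show "\<kappa> q > 0" if "q \<in> {i,j}" "f q < 0" for q
        using that kl f \<kappa> by (cases "\<kappa> q = 0") auto
    qed (use ne kl \<kappa> in auto)
    have "(k + t * f i) *\<^sub>R x i + (l + t * f j) *\<^sub>R x j = T + t *\<^sub>R (f i *\<^sub>R x i + f j *\<^sub>R x j)"
      by (simp add: T algebra_simps)
    then have rep': "representation ((i,j),(k + t * f i, l + t * f j))"
      using t(2)[of i] t(2)[of j] f ij \<kappa> by (simp add: representation_iff)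
    have "\<not> (k + t * f i \<ge> 1/2 \<or> l + t * f j \<ge> 1/2)"
      using orderable_large_pair[OF rep'] small by blast
    then have l': "k + t * f i < 1/2" "l + t * f j < 1/2" by auto
    have "t * (f i + f j) \<ge> 0" using t pos by simp
    then have ge: "k + l \<le> k + t * f i + (l + t * f j)" by (simp add: algebra_simps)
    have "k' + l' \<le> k + t * f i + (l + t * f j)" if "representation ((i',j'),(k',l'))" for i' j' k' l'
      using mx[OF that] ge by linarith
    then have "M ((i,j),(k + t * f i, l + t * f j))"
      using rep' unfolding M_def fst_conv snd_conv by blast
    then have "N r \<le> N ((i,j),(k + t * f i, l + t * f j))" by (rule r(2))
    moreover have "p = i \<and> k + t * f i = 0 \<and> f i < 0 \<or> p = j \<and> l + t * f j = 0 \<and> f j < 0"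
      using t l' \<kappa> by auto
    ultimately show False using f unfolding N_def rr by (auto split: if_splits)
  qed
  note key = this
  have ind: "f i = 0 \<and> f j = 0" if f: "k = 0 \<longrightarrow> f i = 0" "l = 0 \<longrightarrow> f j = 0" "f i *\<^sub>R x i + f j *\<^sub>R x j = 0" for f :: "'i \<Rightarrow> real"
  proof (cases "f i + f j \<ge> 0")
    case True
    then show ?thesis using key[OF f] by blast
  next
    case False
    have "- (f i *\<^sub>R x i + f j *\<^sub>R x j) = 0" using f by simp
    then have "(- f i) *\<^sub>R x i + (- f j) *\<^sub>R x j = 0" by simp
    moreover have "k = 0 \<longrightarrow> - f i = 0" "l = 0 \<longrightarrow> - f j = 0" using f by auto
    moreover have "- f i + - f j \<ge> 0" using False by simp
    ultimately have "\<not> (- f i \<noteq> 0 \<or> - f j \<noteq> 0)" using key[of "\<lambda>p. - f p"] by blast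
    then show ?thesis by simp
  qed
  show ?thesis
    by (rule that[OF rep]) (use mx ind in blast)+
qed

text \<open>The extremal pair is moved along a relation on three vectors that raises the coefficient
  sum. A coefficient reaching 0 would give a better pair; one reaching 1 leads to a triple from
  which vectors can be removed.\<close>

lemma orderable_of_representation:
  assumes rep: "representation r0" and card: "card A \<ge> 3"
  shows "orderable x A"
proof (rule ccontr)
  assume no: "\<not> orderable x A"
  show False
  proof (rule obtain_independent_pair[OF rep no])
    fix i j k l
    assume rep: "representation ((i,j),(k,l))"
      and mx: "\<And>i' j' k' l'. representation ((i',j'),(k',l')) \<Longrightarrow> k' + l' \<le> k + l"
      and ind: "\<And>f. (k = 0 \<longrightarrow> f i = 0) \<Longrightarrow> (l = 0 \<longrightarrow> f j = 0) \<Longrightarrow> f i *\<^sub>R x i + f j *\<^sub>R x j = 0 \<Longrightarrow> f i = (0::real) \<and> f j = 0"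
    have ij: "i \<noteq> j" "i \<in> A" "j \<in> A" and T: "T = k *\<^sub>R x i + l *\<^sub>R x j"
      and kl: "0 \<le> k" "k \<le> 1" "0 \<le> l" "l \<le> 1" using rep by (auto simp: representation_iff)
    have "\<not> (k \<ge> 1/2 \<or> l \<ge> 1/2)" using orderable_large_pair[OF rep] no by blast
    then have lt: "k < 1/2" "l < 1/2" by auto
    define \<kappa> where "\<kappa> = (\<lambda>p. if p = i then k else if p = j then l else 0)"
    have \<kappa>: "\<kappa> i = k" "\<kappa> j = l" using ij by (auto simp: \<kappa>_def)
    have \<kappa>b: "0 \<le> \<kappa> p" "\<kappa> p < 1/2" for p using kl lt by (auto simp: \<kappa>_def)
    define Y where "Y = {p\<in>{i,j}. \<kappa> p \<noteq> 0}"
    have YA: "Y \<subseteq> A" using ij by (auto simp: Y_def)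
    have \<kappa>0: "\<kappa> p = 0" if "p \<notin> Y" for p using that by (auto simp: Y_def \<kappa>_def split: if_splits)
    have \<kappa>T: "(\<Sum>p\<in>F. \<kappa> p *\<^sub>R x p) = T" "(\<Sum>p\<in>F. \<kappa> p) = k + l" if "Y \<subseteq> F" "finite F" for F
    proof -
      have "(\<Sum>p\<in>F. \<kappa> p *\<^sub>R x p) = (\<Sum>p\<in>Y. \<kappa> p *\<^sub>R x p)"
        using that \<kappa>0 by (intro sum.mono_neutral_right) auto
      also have "\<dots> = (\<Sum>p\<in>{i,j}. \<kappa> p *\<^sub>R x p)"
        by (intro sum.mono_neutral_left) (auto simp: Y_def)
      finally show "(\<Sum>p\<in>F. \<kappa> p *\<^sub>R x p) = T" using ij \<kappa> T by simp
      have "(\<Sum>p\<in>F. \<kappa> p) = (\<Sum>p\<in>Y. \<kappa> p)"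
        using that \<kappa>0 by (intro sum.mono_neutral_right) auto
      also have "\<dots> = (\<Sum>p\<in>{i,j}. \<kappa> p)"
        by (intro sum.mono_neutral_left) (auto simp: Y_def)
      finally show "(\<Sum>p\<in>F. \<kappa> p) = k + l" using ij \<kappa> by simp
    qed
    have "\<exists>F d. Y \<subseteq> F \<and> F \<subseteq> A \<and> card F = 3 \<and> (\<Sum>i\<in>F. d i *\<^sub>R x i) = 0 \<and>
             (\<forall>i\<in>F - Y. d i \<ge> 0) \<and> (\<Sum>i\<in>F. d i) > (0::real)"
    \<comment> \<open>The weights \<open>1 - \<kappa> p\<close> form a relation, since the plain sum
      and the \<open>\<kappa>\<close>-weighted sum both equal \<open>T\<close>; they are positive
      because all \<open>\<kappa> p\<close> are below 1/2.\<close>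
    proof (rule small_support_direction[OF dim2 finite_A YA, where w = "\<lambda>p. 1 - \<kappa> p"])
      show "\<forall>p\<in>Y. e p = 0" if "(\<Sum>p\<in>Y. e p *\<^sub>R x p) = 0" for e
      proof -
        define f where "f = (\<lambda>p. if p \<in> Y then e p else 0)"
        have "(\<Sum>p\<in>Y. e p *\<^sub>R x p) = (\<Sum>p\<in>Y. f p *\<^sub>R x p)" by (simp add: f_def)
        also have "\<dots> = (\<Sum>p\<in>{i,j}. f p *\<^sub>R x p)"
          by (intro sum.mono_neutral_left) (auto simp: Y_def f_def)
        finally have "f i *\<^sub>R x i + f j *\<^sub>R x j = 0" using that ij by simp
        then have "f i = 0 \<and> f j = 0" by (intro ind) (auto simp: f_def Y_def \<kappa>)
        then show ?thesis by (auto simp: f_def Y_def split: if_splits)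
      qed
      show "(\<Sum>p\<in>A. (1 - \<kappa> p) *\<^sub>R x p) = 0"
        using \<kappa>T(1)[OF YA finite_A] by (simp add: scaleR_diff_left sum_subtractf T_def)
      show "0 \<le> 1 - \<kappa> p" for p using \<kappa>b[of p] by simp
      have "A \<noteq> {}" using ij by auto
      then show "(\<Sum>p\<in>A. 1 - \<kappa> p) > 0"
        using finite_A \<kappa>b by (intro sum_pos) (auto simp: less_diff_eq intro: less_trans[of _ "1/2"])
    qed (use card in auto)
    then obtain F d where F: "Y \<subseteq> F" "F \<subseteq> A" "card F = 3" and d: "(\<Sum>p\<in>F. d p *\<^sub>R x p) = 0"
        "\<And>p. p \<in> F - Y \<Longrightarrow> d p \<ge> 0" "(\<Sum>p\<in>F. d p) > 0" by blast
    have finF: "finite F" using F finite_A finite_subset by blast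
    obtain t p where t: "t > 0" "\<And>q. q \<in> F \<Longrightarrow> 0 \<le> \<kappa> q + t * d q \<and> \<kappa> q + t * d q \<le> 1"
        "p \<in> F" "\<kappa> p + t * d p = 1 \<and> d p > 0 \<or> \<kappa> p + t * d p = 0 \<and> d p < 0"
    proof (rule ray_to_boundary[of F d \<kappa>])
      show "\<exists>p\<in>F. d p \<noteq> 0"
      proof (rule ccontr)
        assume "\<not> ?thesis"
        then have "(\<Sum>p\<in>F. d p) = 0" by (intro sum.neutral) auto
        then show False using d by simp
      qed
      show "0 \<le> \<kappa> q \<and> \<kappa> q \<le> 1" "\<kappa> q < 1" for q using \<kappa>b[of q] by auto
      show "\<kappa> q > 0" if "q \<in> F" "d q < 0" for q
      proof -
        have "q \<in> Y" using d(2)[of q] that by force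
        then show ?thesis using \<kappa>b[of q] by (auto simp: Y_def)
      qed
    qed (use finF in auto)
    define \<mu> where "\<mu> = (\<lambda>q. \<kappa> q + t * d q)"
    have \<mu>b: "0 \<le> \<mu> q \<and> \<mu> q \<le> 1" if "q \<in> F" for q using t(2) that by (simp add: \<mu>_def)
    have \<mu>T: "(\<Sum>q\<in>F. \<mu> q *\<^sub>R x q) = T"
    proof -
      have "(\<Sum>q\<in>F. \<mu> q *\<^sub>R x q) = (\<Sum>q\<in>F. \<kappa> q *\<^sub>R x q) + t *\<^sub>R (\<Sum>q\<in>F. d q *\<^sub>R x q)"
        by (simp add: \<mu>_def scaleR_add_left sum.distrib scaleR_sum_right)
      then show ?thesis using d \<kappa>T F finF by simp
    qed
    have \<mu>s: "(\<Sum>q\<in>F. \<mu> q) > k + l"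
    proof -
      have "(\<Sum>q\<in>F. \<mu> q) = (\<Sum>q\<in>F. \<kappa> q) + t * (\<Sum>q\<in>F. d q)"
        by (simp add: \<mu>_def sum.distrib sum_distrib_left)
      then show ?thesis using d \<kappa>T F finF t by simp
    qed
    have "card (F - {p}) = 2" using F t(3) finF by simp
    then obtain b e where be: "F - {p} = {b,e}" "b \<noteq> e" by (auto simp: card_2_iff)
    then have Fe: "F = {p,b,e}" "p \<noteq> b" "p \<noteq> e" "p \<in> A" "b \<in> A" "e \<in> A" using t(3) F by auto
    have \<mu>T': "T = \<mu> p *\<^sub>R x p + \<mu> b *\<^sub>R x b + \<mu> e *\<^sub>R x e"
      using \<mu>T Fe be by (simp add: add.assoc)
    have \<kappa>T': "T = \<kappa> p *\<^sub>R x p + \<kappa> b *\<^sub>R x b + \<kappa> e *\<^sub>R x e"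
      using \<kappa>T(1)[OF F(1) finF] Fe be by (simp add: add.assoc)
    have bounds: "0 \<le> \<mu> b" "\<mu> b \<le> 1" "0 \<le> \<mu> e" "\<mu> e \<le> 1" using \<mu>b Fe by auto
    have \<kappa>bb: "0 \<le> \<kappa> q" "\<kappa> q \<le> 1/2" for q using \<kappa>b[of q] by auto
    show False
    proof (cases "\<mu> p = 0")
      case True
      then have "T = \<mu> b *\<^sub>R x b + \<mu> e *\<^sub>R x e" using \<mu>T' by simp
      then have "representation ((b,e),(\<mu> b, \<mu> e))"
        unfolding representation_iff using Fe be bounds by blast
      then have "\<mu> b + \<mu> e \<le> k + l" by (rule mx)
      then show False using \<mu>s Fe be True by simp
    next
      case False
      then have \<mu>1: "\<mu> p = 1" using t(4) by (auto simp: \<mu>_def)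
      \<comment> \<open>At most two of the three vectors in \<open>F\<close> had a nonzero
        coefficient, so some \<open>z\<close> is a newcomer. Whether \<open>z\<close> is the vector
        whose coefficient reached 1 decides which triple lemma applies.\<close>
      have "card Y \<le> card {i,j}" by (rule card_mono) (auto simp: Y_def)
      also have "\<dots> \<le> 2" using ij by simp
      finally have "\<not> F \<subseteq> Y" using F(3) card_mono[of Y F] YA finite_A finite_subset by fastforce
      then obtain z where z: "z \<in> F" "\<kappa> z = 0" using \<kappa>0 by blast
      have T1: "T = x p + \<mu> b *\<^sub>R x b + \<mu> e *\<^sub>R x e" using \<mu>T' \<mu>1 by simp
      note k = \<kappa>bb(1) \<kappa>bb(2) \<kappa>bb(1) \<kappa>bb(2)
      from z(1) Fe(1) consider "z = p" | "z = b" | "z = e" by blast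
      then have "orderable x A"
      proof cases
        case 1
        then have "T = \<kappa> b *\<^sub>R x b + \<kappa> e *\<^sub>R x e" using \<kappa>T' z(2) by simp
        then show ?thesis by (rule orderable_triple_new[OF Fe(4-6) Fe(2,3) be(2) T1 bounds _ k])
      next
        case 2
        then have T0: "T = \<kappa> p *\<^sub>R x p + \<kappa> e *\<^sub>R x e" using \<kappa>T' z(2) by simp
        have "T = x p + \<mu> e *\<^sub>R x e + \<mu> b *\<^sub>R x b" using T1 by (simp only: ac_simps)
        then show ?thesis
          by (rule orderable_triple_old[OF Fe(4,6,5) Fe(3,2) be(2)[symmetric] _ bounds(3,4,1,2) T0 k])
      next
        case 3
        then have "T = \<kappa> p *\<^sub>R x p + \<kappa> b *\<^sub>R x b" using \<kappa>T' z(2) by simp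
        then show ?thesis by (rule orderable_triple_old[OF Fe(4-6) Fe(2,3) be(2) T1 bounds _ k])
      qed
      then show False using no by blast
    qed
  qed
qed

end

section \<open>The induction step for sums near a segment\<close>

context ordering_step
begin

lemma orderable_if_card_le_2:
  assumes "A \<noteq> {}" "card A \<le> 2"
  shows "orderable x A"
proof -
  have "card A = 1 \<or> card A = 2"
    using assms finite_A card_gt_0_iff[of A] by linarith
  then show ?thesis
  proof
    assume "card A = 1"
    then obtain i where "A = {i}" by (auto simp: card_1_singleton_iff)
    then show ?thesis using orderable_A[of i] orderable.empty[of x] by simp
  next
    assume "card A = 2"
    then obtain i j where A: "A = {i,j}" "i \<noteq> j" by (auto simp: card_2_iff)
    then have "T - x i = x j" unfolding T_def by simp
    moreover have "A - {i} - {j} = {}" using A by auto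
    ultimately show ?thesis
      using orderable_remove2[of i j] A norm_le_1[of j] le1_sq[of "x j"] orderable.empty[of x] by auto
  qed
qed

lemma ex_nearest:
  assumes "A \<noteq> {}"
  shows "\<exists>y\<in>A. \<exists>c\<in>{0..1}. \<forall>i\<in>A. \<forall>k\<in>{0..1}. norm (T - c *\<^sub>R x y) \<le> norm (T - k *\<^sub>R x i)"
proof -
  define K where "K = (\<Union>i\<in>A. closed_segment 0 (x i))"
  have "closed K" "K \<noteq> {}" using finite_A assms by (auto simp: K_def intro!: closed_UN)
  then obtain p where p: "p \<in> K" "\<And>q. q \<in> K \<Longrightarrow> dist T p \<le> dist T q"
    using distance_attains_inf[of K T] by blast
  have K: "k *\<^sub>R x i \<in> K" if "i \<in> A" "k \<in> {0..1}" for i k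
    using that by (auto simp: K_def closed_segment_def)
  obtain y c where yc: "y \<in> A" "c \<in> {0..1}" "p = c *\<^sub>R x y"
    using p(1) by (auto simp: K_def closed_segment_def)
  have "norm (T - c *\<^sub>R x y) \<le> norm (T - k *\<^sub>R x i)" if "i \<in> A" "k \<in> {0..1}" for i k
    using p(2)[OF K[OF that]] yc(3) by (simp add: dist_norm)
  then show ?thesis using yc by blast
qed

text \<open>The error \<open>h\<close> of a nearest point on the segments from \<open>0\<close> to the \<open>x i\<close> is either zero or
  orthogonal to that segment, so that it can be shrunk with the help of one further vector.\<close>

lemma orderable_of_near_segment:
  assumes "A \<noteq> {}" and near: "near_segment x A"
  shows "orderable x A"
proof (cases "card A \<le> 2")
  case True
  then show ?thesis using orderable_if_card_le_2 assms by blast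
next
  case False
  then have card: "card A \<ge> 3" by simp
  obtain y c where y: "y \<in> A" and "c \<in> {0..1}" and
    *: "\<forall>i\<in>A. \<forall>k\<in>{0..1}. norm (T - c *\<^sub>R x y) \<le> norm (T - k *\<^sub>R x i)"
    using ex_nearest[OF assms(1)] by blast
  then have c: "0 \<le> c" "c \<le> 1" by auto
  have min: "norm (T - c *\<^sub>R x y) \<le> norm (T - k *\<^sub>R x i)" if "i \<in> A" "0 \<le> k" "k \<le> 1" for i k
    using * that by simp
  define h where "h = T - c *\<^sub>R x y"
  have T: "T = h + c *\<^sub>R x y" by (simp add: h_def)
  have h: "norm h \<le> 1 / 2"
    using near unfolding near_segment_def T_def[symmetric]
  proof
    assume "norm T \<le> 1 / 2"
    then show ?thesis using min[OF y, of 0] by (simp add: h_def)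
  next
    assume "\<exists>y\<in>A. \<exists>c\<in>{0..1}. norm (T - c *\<^sub>R x y) \<le> 1 / 2"
    then obtain i k where "i \<in> A" "0 \<le> k" "k \<le> 1" "norm (T - k *\<^sub>R x i) \<le> 1 / 2" by auto
    then show ?thesis using min[of i k] unfolding h_def by linarith
  qed
  have min': "norm h \<le> norm (h - \<delta> *\<^sub>R x y)" if "- c \<le> \<delta>" "\<delta> \<le> 1 - c" for \<delta>
    using min[OF y, of "c + \<delta>"] that by (simp add: h_def scaleR_add_left diff_diff_eq)
  show ?thesis
  proof (cases "c = 1 \<or> h = 0")
    case True
    then show ?thesis
    proof
      assume "c = 1"
      then have "norm (T - x y) \<le> 1 / 2" using h T by simp
      then have "orderable x (A - {y})"
        using IH[of "A - {y}"] y sum_remove1 small_sq by (auto simp: near_segment_def)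
      then show ?thesis using orderable_A y by blast
    next
      assume "h = 0"
      have "A \<noteq> {y}" using card by auto
      then obtain j where "j \<in> A" "y \<noteq> j" using y by blast
      then have "representation ((y,j),(c,0))" using T y c \<open>h = 0\<close> by (simp add: representation_iff)
      then show ?thesis using orderable_of_representation card by blast
    qed
  next
    case False
    then have c1: "c < 1" and h0: "h \<noteq> 0" using c by auto
    have "h \<bullet> x y \<le> 0"
      by (rule inner_nonpos_if_nearest[of _ "1 - c"]) (use min' c c1 norm_le_1[OF y] in auto)
    then have yle: "x y \<bullet> h \<le> 0" by (simp add: inner_commute)
    have orth: "c * (x y \<bullet> h) = 0"
    proof (cases "c = 0")
      case False
      have "norm h \<le> norm (h - \<delta> *\<^sub>R (- x y))" if "0 \<le> \<delta>" "\<delta> \<le> c" for \<delta>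
        using min'[of "- \<delta>"] that c by simp
      then have "h \<bullet> (- x y) \<le> 0"
        using False c norm_le_1[OF y] by (intro inner_nonpos_if_nearest[of _ c]) auto
      then show ?thesis using yle by (simp add: inner_commute)
    qed simp
    \<comment> \<open>As \<open>h\<close> is orthogonal to \<open>c x y\<close>, the inner products
      with \<open>h\<close> add up to \<open>|h|^2 > 0\<close>, so some \<open>x z\<close> points to
      the side of \<open>h\<close>.\<close>
    have "(\<Sum>i\<in>A. x i \<bullet> h) = T \<bullet> h" by (simp add: T_def inner_sum_left)
    also have "\<dots> = h \<bullet> h" using orth by (subst T) (simp add: inner_add_left)
    also have "\<dots> > 0" using h0 by simp
    finally have "\<exists>z\<in>A. x z \<bullet> h > 0" using sum_nonpos[of A "\<lambda>i. x i \<bullet> h"] by force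
    then obtain z where z: "z \<in> A" "x z \<bullet> h > 0" by blast
    then have zy: "z \<noteq> y" using yle by auto
    \<comment> \<open>Otherwise the nearest point is 0 and a short step along \<open>x z\<close>
      would come closer to \<open>T\<close>.\<close>
    have p0: "c *\<^sub>R x y \<noteq> 0"
    proof
      assume "c *\<^sub>R x y = 0"
      then have "h = T" using T by simp
      then have "h \<bullet> x z \<le> 0"
        by (intro inner_nonpos_if_nearest[of _ 1])
           (use min[OF z(1)] h_def norm_le_1[OF z(1)] \<open>c *\<^sub>R x y = 0\<close> in auto)
      then show False using z by (simp add: inner_commute)
    qed
    then have c0: "c > 0" "x y \<noteq> 0" using c by auto
    \<comment> \<open>This value makes \<open>h - \<zeta> x z\<close> orthogonal to
      \<open>h\<close>, hence parallel to \<open>x y\<close> in the plane; so \<open>h\<close> is a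
      combination of \<open>x y\<close> and \<open>x z\<close>.\<close>
    define \<zeta> where "\<zeta> = (h \<bullet> h) / (x z \<bullet> h)"
    have \<zeta>: "\<zeta> > 0" using z h0 by (simp add: \<zeta>_def)
    have 1: "x y \<bullet> h = 0" using orth c0 by simp
    have 2: "(h - \<zeta> *\<^sub>R x z) \<bullet> h = 0" using z by (simp add: inner_diff_left \<zeta>_def)
    obtain \<alpha> where \<alpha>: "h - \<zeta> *\<^sub>R x z = \<alpha> *\<^sub>R x y"
      by (rule parallel_if_orthogonal_to_same[OF dim2 c0(2) h0 1 2])
    \<comment> \<open>Indices 0, 1, 2 stand for the coefficients of \<open>h\<close>,
      \<open>x y\<close> and \<open>x z\<close>. Moving along \<open>d\<close> replaces a share
      \<open>t\<close> of \<open>h\<close> by its combination, leaving \<open>T\<close>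
      fixed.\<close>
    define k where "k = (\<lambda>n::nat. if n = 0 then 1 else if n = 1 then c else 0)"
    define d where "d = (\<lambda>n::nat. if n = 0 then - 1 else if n = 1 then \<alpha> else \<zeta>)"
    have "\<exists>m\<in>{0,1,2}. d m \<noteq> 0" "\<And>m. 0 \<le> k m \<and> k m \<le> 1"
      "\<And>m. d m > 0 \<Longrightarrow> k m < 1" "\<And>m. d m < 0 \<Longrightarrow> k m > 0"
      using c0 c1 \<zeta> by (auto simp: k_def d_def split: if_splits)
    then obtain t n where t: "t > 0" "\<And>m. m \<in> {0,1,2} \<Longrightarrow> 0 \<le> k m + t * d m \<and> k m + t * d m \<le> 1"
      "n \<in> {0,1,2}" "k n + t * d n = 1 \<and> d n > 0 \<or> k n + t * d n = 0 \<and> d n < 0"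
      using ray_to_boundary[of "{0,1,2::nat}" d k thesis] by blast
    have b: "0 \<le> 1 - t" "0 \<le> c + t * \<alpha>" "c + t * \<alpha> \<le> 1" "0 \<le> t * \<zeta>" "t * \<zeta> \<le> 1"
      using t(2)[of 0] t(2)[of 1] t(2)[of 2] by (auto simp: k_def d_def)
    have "h = \<alpha> *\<^sub>R x y + \<zeta> *\<^sub>R x z" using \<alpha> by (simp add: algebra_simps)
    then have "t *\<^sub>R h = (t * \<alpha>) *\<^sub>R x y + (t * \<zeta>) *\<^sub>R x z" by (simp add: scaleR_add_right)
    then have T': "T = (1 - t) *\<^sub>R h + (c + t * \<alpha>) *\<^sub>R x y + (t * \<zeta>) *\<^sub>R x z"
      by (simp add: T scaleR_diff_left scaleR_add_left)
    have "(1 - t) * norm h \<le> 1 * norm h" using t by (intro mult_right_mono) auto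
    then have h': "norm ((1 - t) *\<^sub>R h) \<le> 1/2" using h b by simp
    from t(3,4) consider "t = 1" | "c + t * \<alpha> = 1" | "c + t * \<alpha> = 0" | "t * \<zeta> = 1"
      using \<zeta> by (auto simp: k_def d_def)
    then show ?thesis
    proof cases
      case 1
      then have "representation ((y,z),(c + \<alpha>, \<zeta>))"
        using T' b y z zy by (simp add: representation_iff)
      then show ?thesis using orderable_of_representation card by blast
    next
      case 2
      then have "T = (1 - t) *\<^sub>R h + x y + (t * \<zeta>) *\<^sub>R x z" using T' by simp
      from orderable_two_step[OF y z(1) zy[symmetric] this h' b(4,5) _ T h c]
      show ?thesis by simp
    next
      case 3
      \<comment> \<open>The segment of \<open>z\<close> would now come closer to \<open>T\<close>
        than the nearest point, so this case is contradictory.\<close>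
      then have "T - (t * \<zeta>) *\<^sub>R x z = (1 - t) *\<^sub>R h" using T' by simp
      then have "norm h \<le> norm ((1 - t) *\<^sub>R h)" using min[OF z(1) b(4,5)] by (simp add: h_def)
      then have "norm h \<le> (1 - t) * norm h" using b by simp
      then have "t * norm h \<le> 0" by (simp add: algebra_simps)
      then show ?thesis using t h0 by (simp add: mult_le_0_iff)
    next
      case 4
      then have "T = (1 - t) *\<^sub>R h + x z + (c + t * \<alpha>) *\<^sub>R x y" using T' by simp
      from orderable_two_step[OF z(1) y zy this h' b(2,3) _ T h c]
      show ?thesis by simp
    qed
  qed
qed

end

text \<open>Strong induction over subsets of \<open>A\<close>; the whole set starts with sum 0 and
  so satisfies the invariant.\<close>

theorem orderable_of_sum_zero:
  fixes x :: "'i \<Rightarrow> 'a::euclidean_space"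
  assumes dim: "DIM('a) = 2" and "finite A" "\<And>i. i \<in> A \<Longrightarrow> norm (x i) \<le> 1" "sum x A = 0"
  shows "orderable x A"
proof -
  have "orderable x B" if "B \<subseteq> A" "(norm (sum x B))\<^sup>2 \<le> 5 / 4" "near_segment x B" for B
    using that
  proof (induction "card B" arbitrary: B rule: less_induct)
    case less
    have fin: "finite B" using less.prems assms finite_subset by blast
    show ?case
    proof (cases "B = {}")
      case True
      then show ?thesis by (simp add: orderable.empty)
    next
      case False
      interpret ordering_step x B
      proof
        show "DIM('a) = 2" "finite B" "(norm (sum x B))\<^sup>2 \<le> 5 / 4"
          by (fact dim fin less.prems(2))+
        show "norm (x i) \<le> 1" if "i \<in> B" for i using that less.prems(1) assms(3) by blast
        show "orderable x C" if C: "C \<subset> B" and "(norm (sum x C))\<^sup>2 \<le> 5 / 4" "near_segment x C" for C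
        proof (rule less.hyps)
          show "card C < card B" using C fin by (rule psubset_card_mono[rotated])
          show "C \<subseteq> A" using C less.prems(1) by blast
        qed fact+
      qed
      show ?thesis by (rule orderable_of_near_segment[OF False less.prems(3)])
    qed
  qed
  then show ?thesis using assms by (simp add: near_segment_def)
qed

text \<open>The sums remaining during the removals belong to a chain of nonempty sets, so they are
  distinct. The empty set is left out, since its sum 0 may coincide with that of all of
  \<open>A\<close>.\<close>

lemma orderable_distinct_sums:
  assumes "orderable x A" "finite A" and "\<And>B C. B \<noteq> {} \<Longrightarrow> B \<subset> C \<Longrightarrow> C \<subseteq> A \<Longrightarrow> sum x B \<noteq> sum x C"
  shows "\<exists>P. P \<subseteq> sum x ` (Pow A - {{}}) \<and> card P = card A \<and> (\<forall>p\<in>P. (norm p)\<^sup>2 \<le> 5 / 4)"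
  using assms
proof (induction rule: orderable.induct)
  case empty
  then show ?case by (intro exI[of _ "{}"]) auto
next
  case (insert i A)
  have "\<exists>P. P \<subseteq> sum x ` (Pow (A - {i}) - {{}}) \<and> card P = card (A - {i}) \<and> (\<forall>p\<in>P. (norm p)\<^sup>2 \<le> 5 / 4)"
  proof (rule insert.IH)
    show "finite (A - {i})" using insert.prems(1) by simp
    show "sum x B \<noteq> sum x C" if "B \<noteq> {}" "B \<subset> C" "C \<subseteq> A - {i}" for B C
      using insert.prems(2)[OF that(1,2)] that(3) by blast
  qed
  then obtain P where P: "P \<subseteq> sum x ` (Pow (A - {i}) - {{}})" "card P = card (A - {i})"
    "\<forall>p\<in>P. (norm p)\<^sup>2 \<le> 5 / 4" by blast
  have "sum x A \<notin> P"
  proof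
    assume "sum x A \<in> P"
    then have "sum x A \<in> sum x ` (Pow (A - {i}) - {{}})" using P(1) by blast
    then obtain B where "B \<subseteq> A - {i}" "B \<noteq> {}" "sum x A = sum x B" unfolding image_iff by blast
    then show False using insert.prems(2)[of B A] insert.hyps(1) by auto
  qed
  moreover have "finite P"
    by (rule finite_subset[OF P(1)]) (simp add: insert.prems(1))
  ultimately have "card (insert (sum x A) P) = card A"
    using P(2) card.remove[OF insert.prems(1) insert.hyps(1)] by simp
  moreover have "insert (sum x A) P \<subseteq> sum x ` (Pow A - {{}})"
    using P(1) insert.hyps(1) by blast
  ultimately show ?case using P(3) insert.hyps(3) by (intro exI[of _ "insert (sum x A) P"]) auto
qed

section \<open>Bounds for the Davenport constant\<close>

text \<open>Each point is the lower left corner of an open unit square. These squares are disjoint,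
  and they lie in the disc of radius \<open>R + 2\<close> because no point of a square is farther
  than 2 from its corner.\<close>

lemma card_gaussian_integers_le:
  fixes P :: "complex set"
  assumes P: "finite P" "\<And>z. z \<in> P \<Longrightarrow> Re z \<in> \<int> \<and> Im z \<in> \<int> \<and> norm z \<le> R" and R: "R \<ge> 0"
  shows "real (card P) \<le> pi * (R + 2)\<^sup>2"
proof -
  define B where "B z = box z (z + Complex 1 1)" for z
  have B: "w \<in> B z \<longleftrightarrow> Re z < Re w \<and> Re w < Re z + 1 \<and> Im z < Im w \<and> Im w < Im z + 1" for w z
    by (simp add: B_def box_def Basis_complex_def)
  have m1: "measure lborel (B z) = 1" for z
    unfolding B_def by (subst measure_lborel_box_eq) (simp add: Basis_complex_def)
  have "disjoint_family_on B P"
    unfolding disjoint_family_on_def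
  proof (intro ballI impI)
    fix y z assume yz: "y \<in> P" "z \<in> P" "y \<noteq> z"
    show "B y \<inter> B z = {}"
    proof (rule ccontr)
      assume "B y \<inter> B z \<noteq> {}"
      then obtain w where w: "w \<in> B y" "w \<in> B z" by blast
      have "Re y \<in> \<int>" "Re z \<in> \<int>" "Im y \<in> \<int>" "Im z \<in> \<int>" using P(2) yz by blast+
      moreover have "\<bar>Re y - Re z\<bar> < 1" "\<bar>Im y - Im z\<bar> < 1" using w by (auto simp: B)
      ultimately have "Re y = Re z" "Im y = Im z"
        using Ints_nonzero_abs_less1[of "Re y - Re z"] Ints_nonzero_abs_less1[of "Im y - Im z"] by auto
      then show False using yz complex_eq_iff by blast
    qed
  qed
  moreover have "B z \<in> sets lborel" "emeasure lborel (B z) \<noteq> \<infinity>" for z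
    by (simp_all add: B_def emeasure_lborel_box_eq)
  ultimately have "measure lborel (\<Union>z\<in>P. B z) = (\<Sum>z\<in>P. measure lborel (B z))"
    using P(1) by (intro measure_finite_Union) auto
  then have "real (card P) = measure lborel (\<Union>z\<in>P. B z)" by (simp add: m1)
  also have "\<dots> \<le> measure lborel (cball (0::complex) (R + 2))"
  proof (rule measure_mono_fmeasurable)
    show "(\<Union>z\<in>P. B z) \<subseteq> cball 0 (R + 2)"
    proof
      fix w assume "w \<in> (\<Union>z\<in>P. B z)"
      then obtain z where z: "z \<in> P" "w \<in> B z" by blast
      have "norm w \<le> norm z + norm (w - z)" by norm
      also have "norm (w - z) \<le> \<bar>Re (w - z)\<bar> + \<bar>Im (w - z)\<bar>" by (rule cmod_le)
      also have "\<dots> \<le> 2" using z by (auto simp: B)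
      finally show "w \<in> cball 0 (R + 2)" using P(2)[OF z(1)] by simp
    qed
    show "(\<Union>z\<in>P. B z) \<in> sets lborel"
      by (intro sets.finite_UN P) (simp add: B_def)
    show "cball 0 (R + 2) \<in> fmeasurable lborel"
      by (intro fmeasurableI emeasure_lborel_cball_finite) simp
  qed
  also have "\<dots> = pi * (R + 2)\<^sup>2" using R by (subst content_cball) (simp_all add: unit_ball_vol_2)
  finally show ?thesis .
qed

section \<open>The upper bound\<close>

definition complex_of_vec :: "int ^ 2 \<Rightarrow> complex" where
  "complex_of_vec v = Complex (real_of_int (v $ 1)) (real_of_int (v $ 2))"

lemma complex_of_vec_sum: "complex_of_vec (sum f B) = (\<Sum>i\<in>B. complex_of_vec (f i))"
  by (induction B rule: infinite_finite_induct) (auto simp: complex_of_vec_def complex_eq_iff)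

lemma complex_of_vec_eq_0_iff: "complex_of_vec v = 0 \<longleftrightarrow> v = 0"
  by (auto simp: complex_of_vec_def complex_eq_iff vec_eq_iff forall_2)

lemma norm_complex_of_vec_le:
  assumes "v \<in> int_ball m" shows "norm (complex_of_vec v) \<le> real m"
proof -
  have "(v $ 1)\<^sup>2 + (v $ 2)\<^sup>2 \<le> (int m)\<^sup>2" using assms by (simp add: int_ball_def sum_2)
  then have "real_of_int ((v $ 1)\<^sup>2 + (v $ 2)\<^sup>2) \<le> real_of_int ((int m)\<^sup>2)" by linarith
  then show ?thesis by (simp add: complex_of_vec_def cmod_def real_le_lsqrt)
qed

text \<open>Minimality is carried over from sub-multisets to index sets, so that equal entries at
  different positions are kept apart.\<close>

lemma minimal_zero_sum_sub_sum:
  assumes "minimal_zero_sum (mset xs)" "B \<noteq> {}" "B \<subset> {..<length xs}"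
  shows "(\<Sum>i\<in>B. xs ! i) \<noteq> 0"
proof -
  define M where "M = image_mset ((!) xs) (mset_set B)"
  have fin: "finite B" using assms(3) finite_subset by blast
  have eq: "mset xs = image_mset ((!) xs) (mset_set {..<length xs})"
    by (metis map_nth mset_map mset_upt lessThan_atLeast0)
  have "M \<subseteq># mset xs"
    unfolding eq M_def using assms(3) by (intro image_mset_subseteq_mono subset_imp_msubset_mset_set) auto
  moreover have "size M < size (mset xs)"
    using psubset_card_mono[OF _ assms(3)] by (simp add: M_def)
  ultimately have "M \<subset># mset xs" by (auto simp: subset_mset.less_le)
  moreover have "M \<noteq> {#}" using assms(2) fin by (simp add: M_def mset_set_empty_iff)
  ultimately have "sum_mset M \<noteq> 0" using assms(1) by (auto simp: minimal_zero_sum_def zero_sum_def)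
  then show ?thesis by (simp add: M_def sum_unfold_sum_mset)
qed

lemma size_minimal_zero_sum_le:
  fixes S :: "(int ^ 2) multiset"
  assumes m: "m \<ge> 1" and S: "set_mset S \<subseteq> int_ball m" and min: "minimal_zero_sum S"
  shows "real (size S) \<le> 5 * pi / 4 * (real m + 4 / sqrt 5)\<^sup>2"
proof -
  obtain xs where xs: "mset xs = S" using ex_mset by blast
  define n where "n = length xs"
  define A where "A = {..<n}"
  define x where "x i = complex_of_vec (xs ! i) /\<^sub>R real m" for i
  have sum_x: "sum x B = complex_of_vec (\<Sum>i\<in>B. xs ! i) /\<^sub>R real m" for B
    by (simp add: x_def complex_of_vec_sum scaleR_sum_right)
  have "(\<Sum>i\<in>A. xs ! i) = 0"
    using min xs by (auto simp: minimal_zero_sum_def zero_sum_def A_def n_def lessThan_atLeast0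
        simp flip: sum_mset_sum_list sum_list_sum_nth)
  then have A0: "sum x A = 0" by (simp add: sum_x complex_of_vec_eq_0_iff)
  have ord: "orderable x A"
  proof (rule orderable_of_sum_zero[OF DIM_complex _ _ A0])
    fix i assume "i \<in> A"
    then have "xs ! i \<in> int_ball m" using S xs by (force simp: A_def n_def)
    then have "norm (complex_of_vec (xs ! i)) \<le> real m" by (rule norm_complex_of_vec_le)
    then show "norm (x i) \<le> 1" using m by (simp add: x_def field_simps)
  qed (simp add: A_def)
  \<comment> \<open>Equal sums would make \<open>C - B\<close> a zero-sum index set; it is proper
    because \<open>B\<close> is nonempty.\<close>
  have ne: "sum x B \<noteq> sum x C" if BC: "B \<noteq> {}" "B \<subset> C" "C \<subseteq> A" for B C
  proof
    assume "sum x B = sum x C"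
    have "finite C" using BC A_def finite_subset by blast
    then have "sum x (C - B) = sum x C - sum x B" using BC by (intro sum_diff) auto
    then have "(\<Sum>i\<in>C - B. xs ! i) = 0"
      using \<open>sum x B = sum x C\<close> m by (simp add: sum_x complex_of_vec_eq_0_iff)
    moreover have "C - B \<noteq> {}" "C - B \<subset> {..<length xs}" using BC by (auto simp: A_def n_def)
    ultimately show False using minimal_zero_sum_sub_sum[of xs "C - B"] min xs by simp
  qed
  have "finite A" by (simp add: A_def)
  then obtain P where P: "P \<subseteq> sum x ` (Pow A - {{}})" "card P = card A" "\<forall>p\<in>P. (norm p)\<^sup>2 \<le> 5 / 4"
    using orderable_distinct_sums[OF ord _ ne] by blast
  have finP: "finite P" by (rule finite_subset[OF P(1)]) (simp add: A_def)
  define Q where "Q = (\<lambda>p. real m *\<^sub>R p) ` P"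
  have "card Q = card P" unfolding Q_def using m by (intro card_image inj_onI) simp
  then have card: "card Q = size S" using P(2) xs by (simp add: A_def n_def flip: size_mset)
  have "real (card Q) \<le> pi * (sqrt 5 / 2 * real m + 2)\<^sup>2"
  proof (rule card_gaussian_integers_le)
    show "finite Q" using finP by (simp add: Q_def)
    fix z assume "z \<in> Q"
    then obtain p where p: "p \<in> P" "z = real m *\<^sub>R p" by (auto simp: Q_def)
    then obtain B where "p = sum x B" using P(1) by blast
    then have "z = complex_of_vec (\<Sum>i\<in>B. xs ! i)" using p m by (simp add: sum_x)
    then have "Re z \<in> \<int> \<and> Im z \<in> \<int>" by (simp only: complex_of_vec_def complex.sel Ints_of_int)
    moreover have "norm p \<le> sqrt (5 / 4)" using P(3) p by (intro real_le_rsqrt) blast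
    then have "norm p \<le> sqrt 5 / 2" by (simp add: real_sqrt_divide)
    then have "real m * norm p \<le> real m * (sqrt 5 / 2)" by (intro mult_left_mono) auto
    then have "norm z \<le> sqrt 5 / 2 * real m" using p by (simp add: mult.commute)
    ultimately show "Re z \<in> \<int> \<and> Im z \<in> \<int> \<and> norm z \<le> sqrt 5 / 2 * real m" by blast
  qed simp
  also have "sqrt 5 / 2 * real m + 2 = sqrt 5 / 2 * (real m + 4 / sqrt 5)"
    by (simp add: field_simps)
  also have "pi * (sqrt 5 / 2 * (real m + 4 / sqrt 5))\<^sup>2 = 5 * pi / 4 * (real m + 4 / sqrt 5)\<^sup>2"
    by (simp add: power_mult_distrib power_divide)
  finally show ?thesis using card by simp
qed

lemma davenport_le:
  assumes "m \<ge> 1"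
  shows "ereal_of_enat (davenport (int_ball m :: (int ^ 2) set))
           \<le> ereal (5 * pi / 4 * (real m + 4 / sqrt 5)\<^sup>2)"
proof -
  define K where "K = 5 * pi / 4 * (real m + 4 / sqrt 5)\<^sup>2"
  have K: "K \<ge> 0" by (simp add: K_def)
  \<comment> \<open>Lengths are natural numbers, so each is bounded by the floor of
    \<open>K\<close>, which can be compared inside \<open>enat\<close>.\<close>
  have "davenport (int_ball m :: (int ^ 2) set) \<le> enat (nat \<lfloor>K\<rfloor>)"
    unfolding davenport_def
  proof (rule SUP_least)
    fix S :: "(int ^ 2) multiset" assume "S \<in> {S. set_mset S \<subseteq> int_ball m \<and> minimal_zero_sum S}"
    then have "real (size S) \<le> K" using size_minimal_zero_sum_le[OF assms] by (simp add: K_def)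
    then show "enat (size S) \<le> enat (nat \<lfloor>K\<rfloor>)" by (simp add: le_nat_floor)
  qed
  then have "ereal_of_enat (davenport (int_ball m :: (int ^ 2) set)) \<le> ereal_of_enat (enat (nat \<lfloor>K\<rfloor>))"
    by (simp only: ereal_of_enat_le_iff)
  also have "\<dots> \<le> ereal K" using K by (simp add: of_nat_floor)
  finally show ?thesis by (simp add: K_def)
qed

section \<open>The lower bound\<close>

lemma sum_mset_component: "sum_mset M $ i = (\<Sum>v\<in>#M. v $ i)"
  by (induction M) auto

text \<open>The triangle with vertices \<open>u\<close>, \<open>v\<close>, \<open>w\<close> is close to an inscribed equilateral one. Its sum
  \<open>(-1, 0)\<close> is chosen such that the multiplicities of \<open>v\<close> and \<open>w\<close> differ by exactly one; being
  coprime, they make the zero-sum sequence minimal.\<close>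

lemma davenport_ge_triangle:
  fixes m q t :: nat
  assumes m: "m \<ge> 3" and q: "q \<le> m - q" and t: "t \<ge> 1" and circ: "(m - q)\<^sup>2 + (t + 1)\<^sup>2 \<le> m\<^sup>2"
  shows "enat (t * (3 * m - 2) + 3 * q - 1) \<le> davenport (int_ball m :: (int ^ 2) set)"
proof -
  define u v w :: "int ^ 2" where "u = vector [int m - 1, 1]" and "v = vector [- int q, int t]"
    and "w = vector [int q - int m, - 1 - int t]"
  \<comment> \<open>By Cramer's rule the multiplicities are the determinants det(v,w), det(w,u) and
    det(u,v), in the order \<open>\<alpha>\<close>, \<open>\<beta>\<close>,
    \<open>\<gamma>\<close>.\<close>
  define \<alpha> \<gamma> where "\<alpha> = q + t * m" and "\<gamma> = (m - 1) * t + q"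
  define \<beta> where "\<beta> = \<gamma> - 1"
  have "2 * 1 \<le> (m - 1) * t" using m t by (intro mult_mono) auto
  then have \<gamma>2: "\<gamma> \<ge> 2" unfolding \<gamma>_def by linarith
  then have \<beta>\<gamma>: "\<gamma> = \<beta> + 1" by (simp add: \<beta>_def)
  have qm: "q \<le> m" using q by simp
  have int: "int \<alpha> = int q + int t * int m" "int \<gamma> = (int m - 1) * int t + int q" "int \<beta> = (int m - 1) * int t + int q - 1"
    using m \<gamma>2 by (auto simp: \<alpha>_def \<gamma>_def \<beta>_def of_nat_diff)
  have comps: "u $ 1 = int m - 1" "u $ 2 = 1" "v $ 1 = - int q" "v $ 2 = int t"
     "w $ 1 = int q - int m" "w $ 2 = - 1 - int t" by (simp_all add: u_def v_def w_def)
  have "u $ 1 \<noteq> v $ 1" "u $ 2 \<noteq> w $ 2" "v $ 2 \<noteq> w $ 2" using comps m t by auto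
  then have dist: "u \<noteq> v" "u \<noteq> w" "v \<noteq> w" by auto
  define S where "S = replicate_mset \<alpha> u + replicate_mset \<beta> v + replicate_mset \<gamma> w"
  have "int ((m - q)\<^sup>2 + (t + 1)\<^sup>2) \<le> int (m\<^sup>2)" using circ by linarith
  then have circ': "(int m - int q)\<^sup>2 + (int t + 1)\<^sup>2 \<le> (int m)\<^sup>2"
    using qm by (simp add: of_nat_diff add.commute)
  have "u \<in> int_ball m"
    using m by (simp add: int_ball_def sum_2 comps power2_eq_square algebra_simps)
  moreover have "(int q)\<^sup>2 \<le> (int m - int q)\<^sup>2" "(int t)\<^sup>2 \<le> (int t + 1)\<^sup>2" using q qm by (intro power_mono; simp)+
  then have "v \<in> int_ball m" using circ'
    unfolding int_ball_def mem_Collect_eq sum_2 comps power2_minus by linarith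
  moreover have "w \<in> int_ball m"
    using circ' by (simp add: int_ball_def sum_2 comps power2_eq_square algebra_simps)
  ultimately have sub: "set_mset S \<subseteq> int_ball m" by (auto simp: S_def)
  have zs: "zero_sum S"
    unfolding zero_sum_def vec_eq_iff forall_2 sum_mset_component S_def
    by (simp add: comps int algebra_simps)
  have "\<not> zero_sum T" if T: "T \<subset># S" "T \<noteq> {#}" for T
  proof
    assume "zero_sum T"
    define a b c where "a = count T u" and "b = count T v" and "c = count T w"
    have le: "count T y \<le> count S y" for y using T(1) by (simp add: mset_subset_eq_count subset_mset.less_imp_le)
    have T_eq: "T = replicate_mset a u + replicate_mset b v + replicate_mset c w"
    proof (rule multiset_eqI)
      fix y show "count T y = count (replicate_mset a u + replicate_mset b v + replicate_mset c w) y"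
        using le[of y] dist by (auto simp: a_def b_def c_def S_def)
    qed
    have b: "b \<le> \<beta>" using le[of v] dist by (simp add: b_def S_def)
    have e1: "int a * (int m - 1) - int b * int q - int c * (int m - int q) = 0"
      and e2: "int a + int b * int t - int c * (1 + int t) = 0"
      using \<open>zero_sum T\<close> unfolding zero_sum_def vec_eq_iff forall_2 sum_mset_component T_eq
      by (simp_all add: comps algebra_simps)
    \<comment> \<open>Eliminating \<open>a\<close> from the two coordinate equations shows that
      \<open>b : c\<close> equals \<open>\<beta> : \<gamma>\<close>.\<close>
    have "int c * int \<beta> = int b * int \<gamma>"
    proof -
      have "int a = int c * (1 + int t) - int b * int t" using e2 by simp
      then have "(int c * (1 + int t) - int b * int t) * (int m - 1) - int b * int q - int c * (int m - int q) = 0"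
        using e1 by simp
      then show ?thesis unfolding int by (simp add: algebra_simps)
    qed
    then have cb: "c * \<beta> = b * (\<beta> + 1)" using \<beta>\<gamma> by (metis of_nat_eq_iff of_nat_mult)
    \<comment> \<open>Consecutive numbers are coprime, so \<open>\<beta>\<close> divides
      \<open>b\<close>; here this is made explicit by \<open>b = Suc d * \<beta>\<close>.\<close>
    have "b = 0 \<or> b = \<beta> \<and> \<beta> > 0"
    proof (cases "b = 0")
      case False
      then have "b * \<beta> < c * \<beta>" using cb by simp
      then obtain d where "c = Suc (b + d)" using less_imp_Suc_add by auto
      then have "b = Suc d * \<beta>" using cb by (simp add: algebra_simps)
      then show ?thesis using b False by auto
    qed simp
    then consider "b = 0" | "b = \<beta>" "\<beta> > 0" by blast
    then show False
    proof cases
      case 1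
      have "\<beta> > 0" using \<gamma>2 \<beta>\<gamma> by simp
      then have "c = 0" using cb 1 by simp
      then have "a = 0" using e2 1 by simp
      then show False using T(2) T_eq 1 \<open>c = 0\<close> by simp
    next
      case 2
      then have "c * \<beta> = \<gamma> * \<beta>" using cb \<beta>\<gamma> by (simp add: algebra_simps)
      then have "c = \<gamma>" using 2(2) by simp
      then have "int a = int \<alpha>" using e2 2 unfolding int by (simp add: int algebra_simps)
      then have "T = S" using T_eq S_def 2 \<open>c = \<gamma>\<close> by simp
      then show False using T(1) by simp
    qed
  qed
  then have "minimal_zero_sum S" using zs by (auto simp: minimal_zero_sum_def)
  then have "enat (size S) \<le> davenport (int_ball m :: (int ^ 2) set)"
    unfolding davenport_def using sub by (intro SUP_upper) auto
  moreover have "int (size S) = int (t * (3 * m - 2) + 3 * q - 1)"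
  proof -
    have "t * (3 * m - 2) \<ge> 1 * 1" using m t by (intro mult_mono) auto
    then have "int (t * (3 * m - 2) + 3 * q - 1) = int t * int (3 * m - 2) + 3 * int q - 1"
      by (subst of_nat_diff) (linarith, simp)
    moreover have "int (3 * m - 2) = 3 * int m - 2" using m by (simp add: of_nat_diff)
    ultimately have "int (t * (3 * m - 2) + 3 * q - 1) = int t * (3 * int m - 2) + 3 * int q - 1"
      by simp
    then show ?thesis by (simp add: S_def int algebra_simps)
  qed
  ultimately show ?thesis by simp
qed

lemma davenport_ge:
  assumes m: "m \<ge> 5"
  shows "ereal (3 * sqrt 3 / 2 * (real m)\<^sup>2 - 10 * real m) \<le> ereal_of_enat (davenport (int_ball m :: (int ^ 2) set))"
proof -
  define s where "s = sqrt 3 / 2 * real m"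
  have sqrt3: "17 / 10 \<le> sqrt 3" "sqrt 3 \<le> 2"
    by (rule real_le_rsqrt, simp add: power2_eq_square) (rule real_le_lsqrt, auto)
  have s2: "s * s = 3 / 4 * (real m * real m)" by (simp add: s_def)
  have "17 / 10 * 5 \<le> sqrt 3 * real m" using sqrt3 m by (intro mult_mono) auto
  then have s4: "s \<ge> 4" by (simp add: s_def)
  \<comment> \<open>The equilateral triangle would have \<open>q = m / 2\<close> and
    \<open>t\<close> near \<open>s\<close>. Lowering \<open>t\<close> by 2 gains \<open>2 s\<close>
    in the circle condition, which pays for the \<open>m / 2\<close> lost in rounding
    \<open>m - q\<close> up.\<close>
  define q t where "q = m div 2" and "t = nat \<lfloor>s\<rfloor> - 2"
  have "nat \<lfloor>s\<rfloor> \<ge> 4" using s4 by (simp add: le_nat_iff le_floor_iff)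
  then have t2: "t \<ge> 2" "nat \<lfloor>s\<rfloor> = t + 2" by (auto simp: t_def)
  then have ts: "real t + 2 \<le> s" "s < real t + 3"
    using s4 by linarith+
  have q: "q \<le> m - q" "q \<le> m" "2 * real q \<ge> real m - 1" 
    unfolding q_def by linarith+
  have "real ((m - q)\<^sup>2 + (t + 1)\<^sup>2) = (real (m - q))\<^sup>2 + (real (t + 1))\<^sup>2"
    by (simp only: of_nat_add of_nat_power)
  also have "\<dots> \<le> ((real m + 1) / 2)\<^sup>2 + (s - 1)\<^sup>2"
  proof (intro add_mono power_mono)
    show "real (m - q) \<le> (real m + 1) / 2" using q by (simp add: of_nat_diff)
    show "real (t + 1) \<le> s - 1" using ts by simp
  qed auto
  also have "\<dots> = (real m)\<^sup>2 + real m / 2 + 5 / 4 - 2 * s"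
    using s2 by (simp add: power2_eq_square field_simps)
  also have "\<dots> \<le> real (m\<^sup>2)"
  proof -
    have "17 / 10 * real m \<le> sqrt 3 * real m" using sqrt3 by (intro mult_right_mono) auto
    then have "2 * s \<ge> 17 / 10 * real m" by (simp add: s_def)
    moreover have "real m \<ge> 5" using m by simp
    ultimately show ?thesis by simp
  qed
  finally have "(m - q)\<^sup>2 + (t + 1)\<^sup>2 \<le> m\<^sup>2" by (simp only: of_nat_le_iff)
  then have "enat (t * (3 * m - 2) + 3 * q - 1) \<le> davenport (int_ball m :: (int ^ 2) set)"
    using m q t2 by (intro davenport_ge_triangle) auto
  then have "ereal_of_enat (enat (t * (3 * m - 2) + 3 * q - 1)) \<le> ereal_of_enat (davenport (int_ball m :: (int ^ 2) set))"
    by (simp only: ereal_of_enat_le_iff)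
  moreover have "3 * sqrt 3 / 2 * (real m)\<^sup>2 - 10 * real m \<le> real (t * (3 * m - 2) + 3 * q - 1)"
  proof -
    have "t * (3 * m - 2) \<ge> 1 * 1" using m t2 by (intro mult_mono) auto
    then have "real (t * (3 * m - 2) + 3 * q - 1) = real (t * (3 * m - 2) + 3 * q) - real 1"
      by (intro of_nat_diff) linarith
    moreover have "real (3 * m - 2) = 3 * real m - 2" using m by (simp add: of_nat_diff)
    ultimately have eq: "real (t * (3 * m - 2) + 3 * q - 1) = real t * (3 * real m - 2) + 3 * real q - 1"
      by (simp only: of_nat_add of_nat_mult of_nat_1 of_nat_numeral)
    \<comment> \<open>Replacing \<open>t\<close> by its lower bound \<open>s - 3\<close> costs only
      a linear term.\<close>
    have "(s - 3) * (3 * real m - 2) \<le> real t * (3 * real m - 2)" using ts m by (intro mult_right_mono) auto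
    moreover have "(s - 3) * (3 * real m - 2) = 3 * sqrt 3 / 2 * (real m)\<^sup>2 - sqrt 3 * real m - 9 * real m + 6"
      by (simp add: s_def power2_eq_square field_simps)
    moreover have "sqrt 3 * real m \<le> 2 * real m" using sqrt3 by (intro mult_right_mono) auto
    ultimately show ?thesis using q unfolding eq by linarith
  qed
  ultimately show ?thesis unfolding ereal_of_enat_simps by (meson ereal_less_eq(3) order_trans)
qed

theorem theorem1:
  "(\<forall>m::nat. m \<ge> 5 \<longrightarrow>
      ereal (64 / 25 * (real m)\<^sup>2 - 23 * real m + 51)
        \<le> ereal_of_enat (davenport (int_ball m :: (int ^ 2) set)) \<and>
      ereal_of_enat (davenport (int_ball m :: (int ^ 2) set))
        \<le> ereal (5 * pi / 4 * (real m + 4 / sqrt 5)\<^sup>2)) \<and>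
   (\<exists>f g :: nat \<Rightarrow> real.
      f \<in> O(\<lambda>m. real m powr (11 / 10)) \<and> g \<in> O(\<lambda>m. real m) \<and>
      (\<forall>\<^sub>F m in sequentially.
        ereal (3 * sqrt 3 / 2 * (real m)\<^sup>2 + f m)
          \<le> ereal_of_enat (davenport (int_ball m :: (int ^ 2) set)) \<and>
        ereal_of_enat (davenport (int_ball m :: (int ^ 2) set))
          \<le> ereal (5 * pi / 4 * (real m)\<^sup>2 + g m)))"
proof (intro conjI allI impI)
  fix m :: nat assume m: "m \<ge> 5"
  have "ereal (64 / 25 * (real m)\<^sup>2 - 23 * real m + 51) \<le> ereal (3 * sqrt 3 / 2 * (real m)\<^sup>2 - 10 * real m)"
  proof -
    \<comment> \<open>The constant is 2/3 of 64/25; the linear terms compare because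
      \<open>13 m \<ge> 51\<close>.\<close>
    have "128 / 75 \<le> sqrt 3" by (rule real_le_rsqrt) (simp add: power2_eq_square)
    then have "64 / 25 * (real m)\<^sup>2 \<le> 3 * sqrt 3 / 2 * (real m)\<^sup>2" by (intro mult_right_mono) auto
    moreover have "real m \<ge> 5" using m by simp
    ultimately show ?thesis unfolding ereal_less_eq by linarith
  qed
  also have "\<dots> \<le> ereal_of_enat (davenport (int_ball m :: (int ^ 2) set))" by (rule davenport_ge[OF m])
  finally show "ereal (64 / 25 * (real m)\<^sup>2 - 23 * real m + 51)
        \<le> ereal_of_enat (davenport (int_ball m :: (int ^ 2) set))" .
  show "ereal_of_enat (davenport (int_ball m :: (int ^ 2) set))
        \<le> ereal (5 * pi / 4 * (real m + 4 / sqrt 5)\<^sup>2)"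
    using m by (intro davenport_le) simp
next
  \<comment> \<open>\<open>g\<close> is exactly the excess over the leading term; the squares of
    \<open>m\<close> cancel, so it is linear. \<open>f\<close> is linear as well, which is stronger
    than the required exponent 11/10.\<close>
  define f g :: "nat \<Rightarrow> real" where "f m = - 10 * real m"
    and "g m = 5 * pi / 4 * (real m + 4 / sqrt 5)\<^sup>2 - 5 * pi / 4 * (real m)\<^sup>2" for m
  have "f \<in> O(\<lambda>m. real m powr (11 / 10))"
    unfolding f_def by real_asymp
  moreover have "g \<in> O(\<lambda>m. real m)"
    unfolding g_def by real_asymp
  moreover have "\<forall>\<^sub>F m in sequentially.
        ereal (3 * sqrt 3 / 2 * (real m)\<^sup>2 + f m)
          \<le> ereal_of_enat (davenport (int_ball m :: (int ^ 2) set)) \<and>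
        ereal_of_enat (davenport (int_ball m :: (int ^ 2) set))
          \<le> ereal (5 * pi / 4 * (real m)\<^sup>2 + g m)"
    using eventually_ge_at_top[of 5]
  proof eventually_elim
    case (elim m)
    then show ?case using davenport_ge[of m] davenport_le[of m] by (simp add: f_def g_def)
  qed
  ultimately show "\<exists>f g :: nat \<Rightarrow> real.
      f \<in> O(\<lambda>m. real m powr (11 / 10)) \<and> g \<in> O(\<lambda>m. real m) \<and>
      (\<forall>\<^sub>F m in sequentially.
        ereal (3 * sqrt 3 / 2 * (real m)\<^sup>2 + f m)
          \<le> ereal_of_enat (davenport (int_ball m :: (int ^ 2) set)) \<and>
        ereal_of_enat (davenport (int_ball m :: (int ^ 2) set))
          \<le> ereal (5 * pi / 4 * (real m)\<^sup>2 + g m))" by blast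
qed

end
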